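(* Let $E \subset \mathbb{R}^n$ be a subset, $X\subset\mathbb{R}^n$ a linear subspace, and let $f:E \to \mathbb{R}$, $G: E \to \mathbb{R}^n$ be functions with $G$ non-constant. Put $Y:=\mathrm{span}\{G(x)-G(y) : x,y\in E\}$. Assume the following four conditions. (i) $G$ is continuous and bounded on $E$, and $f(x)\geq f(y)+\langle G(y), x-y\rangle$ for all $x,y\in E$. (ii) $Y\subseteq X$. (iii) If $Y\neq X$, and we denote $k=\dim Y$ and $d=\dim X$, there are points $p_1,\ldots,p_{d-k}\in\mathbb{R}^n\setminus\overline{E}$, a number $\varepsilon\in(0,1)$, and linearly independent unit vectors $w_1,\ldots,w_{d-k}\in X\cap Y^{\perp}$ such that, for every $j=1,\ldots,d-k$, the cone $$V_j:=\{x\in\mathbb{R}^n : \varepsilon\langle w_j,x-p_j\rangle\geq |P_Y(x-p_j)|\}$$ satisfies $V_j\cap\overline{E}=\emptyset$. (iv) If $(x_j)_j,(z_j)_j$ are sequences in $E$ such that $(P_X(x_j))_j$ is bounded, then $$\lim_{j\to\infty}\left(f(x_j)-f(z_j)-\langle G(z_j),x_j-z_j\rangle\right)=0\implies \lim_{j\to\infty}|G(x_j)-G(z_j)|=0.$$ Then there exists a Lipschitz convex function $F:\mathbb{R}^n\to\mathbb{R}$ of class $C^1(\mathbb{R}^n)$ such that $F=f$ and $\nabla F=G$ on $E$, $X_F=X$, and $$\mathrm{Lip}(F)=\sup_{x\in\mathbb{R}^n}|\nabla F(x)|=\sup_{y\in E}|G(y)|.$$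
   Context: $|\cdot|$ and $\langle\cdot,\cdot\rangle$ are the Euclidean norm and inner product on $\mathbb{R}^n$. For a linear subspace $Z\subset\mathbb{R}^n$, $Z^\perp$ is its orthogonal complement and $P_Z:\mathbb{R}^n\to Z$ is the orthogonal projection onto $Z$. $\mathrm{Lip}(F)$ is the (best) Lipschitz constant of $F$ on $\mathbb{R}^n$. For every convex function $F:\mathbb{R}^n\to\mathbb{R}$, $X_F$ denotes the unique linear subspace of $\mathbb{R}^n$ for which there are a convex coercive function $c:X_F\to\mathbb{R}$ and a vector $v\in\mathbb{R}^n$ with $F(x)=c(P_{X_F}(x))+\langle v,x\rangle$ for all $x\in\mathbb{R}^n$ (existence and uniqueness of $X_F$ is a known fact). Coercive means $c(x)\to+\infty$ as $|x|\to\infty$, $x\in X_F$. *)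

theory Defs
  imports "HOL-Analysis.Analysis"
begin

definition orth_proj :: "'a::euclidean_space set \<Rightarrow> 'a \<Rightarrow> 'a"
  where "orth_proj Z x = (THE z. z \<in> Z \<and> x - z \<in> Z\<^sup>\<bottom>)"

(* The filter at_infinity is restricted to Z, so c need only be meaningful on Z;
   for Z = {0} the condition is vacuous. *)
definition coercive_on :: "'a::euclidean_space set \<Rightarrow> ('a \<Rightarrow> real) \<Rightarrow> bool"
  where "coercive_on Z c \<longleftrightarrow> filterlim c at_top (inf at_infinity (principal Z))"

definition coercivity_space :: "('a::euclidean_space \<Rightarrow> real) \<Rightarrow> 'a set \<Rightarrow> bool"
  where "coercivity_space F Z \<longleftrightarrow> subspace Z \<and>
    (\<exists>c v. convex_on Z c \<and> coercive_on Z c \<and> (\<forall>x. F x = c (orth_proj Z x) + v \<bullet> x))"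

(* The subspace usually written X with index F; only meaningful for convex F. *)
definition coercive_directions :: "('a::euclidean_space \<Rightarrow> real) \<Rightarrow> 'a set"
  where "coercive_directions F = (THE Z. coercivity_space F Z)"

(* The best Lipschitz constant on the whole space; only meaningful for Lipschitz F. *)
definition Lip :: "('a::euclidean_space \<Rightarrow> real) \<Rightarrow> real"
  where "Lip F = Inf {L. L-lipschitz_on UNIV F}"

definition cone_at :: "'a::euclidean_space set \<Rightarrow> real \<Rightarrow> 'a \<Rightarrow> 'a \<Rightarrow> 'a set"
  where "cone_at Y \<epsilon> w p = {x. \<epsilon> * (w \<bullet> (x - p)) \<ge> norm (orth_proj Y (x - p))}"

lemma orth_proj_ex1:
  fixes Z :: "'a::euclidean_space set"
  assumes "subspace Z"
  shows "\<exists>!z. z \<in> Z \<and> x - z \<in> Z\<^sup>\<bottom>"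
proof (rule ex_ex1I)
  obtain y z where "y \<in> span Z" "\<And>w. w \<in> span Z \<Longrightarrow> orthogonal z w" "x = y + z"
    using orthogonal_subspace_decomp_exists[of Z x] by metis
  then show "\<exists>z. z \<in> Z \<and> x - z \<in> Z\<^sup>\<bottom>"
    using span_eq_iff[THEN iffD2, OF assms]
    by (intro exI[of _ y]) (simp add: orthogonal_comp_def orthogonal_commute)
next
  fix a b
  assume a: "a \<in> Z \<and> x - a \<in> Z\<^sup>\<bottom>" and b: "b \<in> Z \<and> x - b \<in> Z\<^sup>\<bottom>"
  then have "(x - b) - (x - a) \<in> Z\<^sup>\<bottom>"
    by (meson subspace_diff subspace_orthogonal_comp)
  moreover have "a - b \<in> Z"
    using a b assms by (simp add: subspace_diff)
  ultimately have "(a - b) \<bullet> (a - b) = 0"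
    by (auto simp: orthogonal_comp_def orthogonal_def)
  then show "a = b" by simp
qed

lemma orth_proj_props:
  assumes "subspace Z"
  shows "orth_proj Z x \<in> Z" "x - orth_proj Z x \<in> Z\<^sup>\<bottom>"
  using theI'[OF orth_proj_ex1[OF assms, of x]] by (auto simp: orth_proj_def)

lemma orth_proj_eqI:
  assumes "subspace Z" "z \<in> Z" "x - z \<in> Z\<^sup>\<bottom>"
  shows "orth_proj Z x = z"
  unfolding orth_proj_def using orth_proj_ex1[OF assms(1), of x] assms(2,3) by (intro the1_equality) auto

lemma orth_proj_scaleR:
  assumes "subspace Z"
  shows "orth_proj Z (t *\<^sub>R x) = t *\<^sub>R orth_proj Z x"
proof (rule orth_proj_eqI[OF assms])
  show "t *\<^sub>R orth_proj Z x \<in> Z"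
    using assms by (simp add: orth_proj_props subspace_scale)
  have "t *\<^sub>R (x - orth_proj Z x) \<in> Z\<^sup>\<bottom>"
    using assms by (simp add: orth_proj_props subspace_orthogonal_comp subspace_scale)
  then show "t *\<^sub>R x - t *\<^sub>R orth_proj Z x \<in> Z\<^sup>\<bottom>"
    by (simp add: scaleR_diff_right)
qed

lemma coercivity_space_orthogonal_comp:
  fixes F :: "'a::euclidean_space \<Rightarrow> real"
  assumes "coercivity_space F Z"
  shows "Z\<^sup>\<bottom> = {w. \<forall>t. F (t *\<^sub>R w) + F (- (t *\<^sub>R w)) = 2 * F 0}"
proof -
  obtain c v where Z: "subspace Z" and c: "coercive_on Z c"
      and F: "\<And>x. F x = c (orth_proj Z x) + v \<bullet> x"
    using assms by (auto simp: coercivity_space_def)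
  have P: "orth_proj Z (t *\<^sub>R w) = t *\<^sub>R orth_proj Z w"
       "orth_proj Z (- (t *\<^sub>R w)) = (- t) *\<^sub>R orth_proj Z w" for t w
    using orth_proj_scaleR[OF Z, of t w] orth_proj_scaleR[OF Z, of "-t" w] by simp_all
  have P0: "orth_proj Z 0 = 0"
    using orth_proj_scaleR[OF Z, of 0 0] by simp
  have sum: "F (t *\<^sub>R w) + F (- (t *\<^sub>R w)) = c (t *\<^sub>R orth_proj Z w) + c ((- t) *\<^sub>R orth_proj Z w)" for t w
    by (simp add: F P)
  have F0: "F 0 = c 0" by (simp add: F P0)
  show ?thesis
  proof (intro set_eqI iffI)
    fix w assume "w \<in> Z\<^sup>\<bottom>"
    then have "orth_proj Z w = 0"
      using Z by (intro orth_proj_eqI) (auto simp: subspace_0)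
    then show "w \<in> {w. \<forall>t. F (t *\<^sub>R w) + F (- (t *\<^sub>R w)) = 2 * F 0}"
      unfolding mem_Collect_eq sum F0 by simp
  next
    fix w assume w: "w \<in> {w. \<forall>t. F (t *\<^sub>R w) + F (- (t *\<^sub>R w)) = 2 * F 0}"
    define u where "u = orth_proj Z w"
    have u: "u \<in> Z" by (simp add: u_def orth_proj_props Z)
    have "u = 0"
    proof (rule ccontr)
      assume "u \<noteq> 0"
      from c have "eventually (\<lambda>x. c x > c 0) (inf at_infinity (principal Z))"
        unfolding coercive_on_def filterlim_at_top_dense by blast
      then obtain b where b: "\<And>x. norm x \<ge> b \<Longrightarrow> x \<in> Z \<Longrightarrow> c x > c 0"
        by (auto simp: eventually_inf_principal eventually_at_infinity)
      define t where "t = \<bar>b\<bar> / norm u"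
      have "norm (t *\<^sub>R u) \<ge> b" "norm ((- t) *\<^sub>R u) \<ge> b"
        using \<open>u \<noteq> 0\<close> by (auto simp: t_def)
      then have "c (t *\<^sub>R u) > c 0" "c ((- t) *\<^sub>R u) > c 0"
        using b u Z by (meson subspace_scale)+
      moreover have "c (t *\<^sub>R u) + c ((- t) *\<^sub>R u) = 2 * c 0"
        using w unfolding mem_Collect_eq sum F0 u_def by blast
      ultimately show False by linarith
    qed
    then show "w \<in> Z\<^sup>\<bottom>"
      using orth_proj_props(2)[OF Z, of w] by (simp add: u_def)
  qed
qed

lemma coercivity_space_unique:
  fixes F :: "'a::euclidean_space \<Rightarrow> real"
  assumes "coercivity_space F Z" "coercivity_space F Z'"
  shows "Z = Z'"
proof -
  have "Z\<^sup>\<bottom> = Z'\<^sup>\<bottom>"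
    using assms by (simp add: coercivity_space_orthogonal_comp)
  then have "Z\<^sup>\<bottom>\<^sup>\<bottom> = Z'\<^sup>\<bottom>\<^sup>\<bottom>" by simp
  then show ?thesis
    using assms by (simp add: coercivity_space_def orthogonal_comp_self)
qed

lemma coercive_directions_eq:
  fixes F :: "'a::euclidean_space \<Rightarrow> real"
  assumes "coercivity_space F Z"
  shows "coercive_directions F = Z"
  unfolding coercive_directions_def
  by (rule the_equality) (use assms coercivity_space_unique in blast)+

end

theory Submission
  imports Defs
begin

text \<open>Let \<open>m\<close> be the supremum of the affine functions \<open>f z + G z \<bullet> (x - z)\<close>, \<open>z \<in> E\<close>. If \<open>Y \<noteq> X\<close>, add
  finitely many affine functions with gradients \<open>a + \<delta> w\<^sub>j\<close>, where \<open>a\<close> is an average of finitely many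
  gradients; \<open>norm a < M = sup norm G\<close> leaves room for \<open>\<delta> w\<^sub>j\<close>, and the cones \<open>V\<^sub>j\<close> keep the new functions
  strictly below \<open>m\<close> on \<open>E\<close>. Then \<open>m\<close> is convex, \<open>M\<close>-Lipschitz, up to a linear function coercive on \<open>X\<close>
  and constant along \<open>X\<^sup>\<bottom>\<close>, and by (iv) differentiable on \<open>K = closure (E + X\<^sup>\<bottom>)\<close>. The infimum over
  \<open>z\<close> of the smoothed cones \<open>m z + M * sqrt ((norm (x - z))\<^sup>2 + (infdist z K)\<^sup>4)\<close> is an \<open>M\<close>-Lipschitz
  majorant of \<open>m\<close> which agrees with \<open>m\<close> on \<open>K\<close> and has a Frechet supergradient everywhere. Passing to the
  convex envelope preserves all of this, and a convex function with supergradients everywhere is \<open>C\<^sup>1\<close>.\<close>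

section \<open>Orthogonal projections\<close>

lemma orth_proj_add_orthogonal:
  assumes "subspace Z" "w \<in> Z\<^sup>\<bottom>"
  shows "orth_proj Z (x + w) = orth_proj Z x"
proof (rule orth_proj_eqI[OF assms(1)])
  show "orth_proj Z x \<in> Z"
    by (simp add: orth_proj_props assms)
  have "(x - orth_proj Z x) + w \<in> Z\<^sup>\<bottom>"
    by (intro subspace_add subspace_orthogonal_comp orth_proj_props assms)
  then show "x + w - orth_proj Z x \<in> Z\<^sup>\<bottom>"
    by (simp add: algebra_simps)
qed

lemma orth_proj_diff:
  assumes "subspace Z"
  shows "orth_proj Z (x - y) = orth_proj Z x - orth_proj Z y"
proof (rule orth_proj_eqI[OF assms])
  show "orth_proj Z x - orth_proj Z y \<in> Z"
    by (intro subspace_diff orth_proj_props assms)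
  have "(x - orth_proj Z x) - (y - orth_proj Z y) \<in> Z\<^sup>\<bottom>"
    by (intro subspace_diff subspace_orthogonal_comp orth_proj_props assms)
  then show "x - y - (orth_proj Z x - orth_proj Z y) \<in> Z\<^sup>\<bottom>"
    by (simp add: algebra_simps)
qed

lemma inner_orthogonal_comp: "g \<in> Z \<Longrightarrow> w \<in> Z\<^sup>\<bottom> \<Longrightarrow> g \<bullet> w = 0"
  by (auto simp: orthogonal_comp_def orthogonal_def)

lemma inner_orth_proj:
  assumes "subspace Z" "g \<in> Z"
  shows "g \<bullet> orth_proj Z x = g \<bullet> x"
  using inner_orthogonal_comp[OF assms(2) orth_proj_props(2)[OF assms(1), of x]]
  by (simp add: inner_diff_right)

lemma norm_orth_proj_le:
  assumes "subspace Z"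
  shows "norm (orth_proj Z x) \<le> norm x"
proof -
  have "norm (orth_proj Z x) * norm (orth_proj Z x) = orth_proj Z x \<bullet> x"
    using inner_orth_proj[OF assms orth_proj_props(1)[OF assms], of x x]
    by (simp add: dot_square_norm power2_eq_square)
  also have "\<dots> \<le> norm (orth_proj Z x) * norm x"
    by (rule norm_cauchy_schwarz)
  finally show ?thesis
    by (cases "orth_proj Z x = 0") auto
qed

lemma lipschitz_on_UNIV_I:
  fixes h :: "'a::real_normed_vector \<Rightarrow> real"
  assumes "0 \<le> L" and le: "\<And>x y. h y \<le> h x + L * norm (y - x)"
  shows "L-lipschitz_on UNIV h"
proof (rule lipschitz_onI)
  fix x y
  show "dist (h x) (h y) \<le> L * dist x y"
    using le[of x y] le[of y x] by (auto simp: dist_real_def dist_norm norm_minus_commute)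
qed fact

section \<open>Supergradients\<close>

text \<open>The upper half of Frechet differentiability: \<open>\<xi>\<close> lies in the Frechet
  superdifferential. Only upper bounds occur, so the property passes to any smaller function that
  touches at \<open>x\<close>, which suits infima and convex envelopes.\<close>

definition has_supergradient :: "('a::euclidean_space \<Rightarrow> real) \<Rightarrow> 'a \<Rightarrow> 'a \<Rightarrow> bool"
  where "has_supergradient h \<xi> x \<longleftrightarrow>
    (\<forall>e>0. \<exists>d>0. \<forall>u. norm u < d \<longrightarrow> h (x + u) \<le> h x + \<xi> \<bullet> u + e * norm u)"

lemma has_supergradient_quadratic:
  assumes "0 \<le> K" and le: "\<And>u. h (x + u) \<le> h x + \<xi> \<bullet> u + K * (norm u)\<^sup>2"
  shows "has_supergradient h \<xi> x"
  unfolding has_supergradient_def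
proof (intro allI impI)
  fix e :: real assume "e > 0"
  show "\<exists>d>0. \<forall>u. norm u < d \<longrightarrow> h (x + u) \<le> h x + \<xi> \<bullet> u + e * norm u"
  proof (intro exI[of _ "e / (K + 1)"] conjI allI impI)
    show "0 < e / (K + 1)"
      using \<open>e > 0\<close> \<open>0 \<le> K\<close> by simp
    fix u :: 'a assume "norm u < e / (K + 1)"
    then have "(K + 1) * norm u \<le> e"
      using \<open>0 \<le> K\<close> by (simp add: field_simps)
    then have "K * norm u \<le> e"
      using norm_ge_zero[of u] unfolding distrib_right by linarith
    then have "K * norm u * norm u \<le> e * norm u"
      by (intro mult_right_mono) auto
    then show "h (x + u) \<le> h x + \<xi> \<bullet> u + e * norm u"
      using le[of u] by (simp add: power2_eq_square mult.assoc)
  qed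
qed

text \<open>The quadratic excess is absorbed by half of \<open>e\<close>, the other half being spent
  on \<open>g\<close>. This serves at contact points, where a majorant of \<open>g\<close> leaves it
  only to second order.\<close>

lemma has_supergradient_majorant:
  assumes g: "has_supergradient g \<xi> x" and "h x = g x" "0 \<le> K"
    and le: "\<And>u. h (x + u) \<le> g (x + u) + K * (norm u)\<^sup>2"
  shows "has_supergradient h \<xi> x"
  unfolding has_supergradient_def
proof (intro allI impI)
  fix e :: real assume "e > 0"
  then obtain d where "d > 0"
    and d: "\<And>u. norm u < d \<Longrightarrow> g (x + u) \<le> g x + \<xi> \<bullet> u + e / 2 * norm u"
    using g unfolding has_supergradient_def by (meson half_gt_zero)
  show "\<exists>d>0. \<forall>u. norm u < d \<longrightarrow> h (x + u) \<le> h x + \<xi> \<bullet> u + e * norm u"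
  proof (intro exI[of _ "min d (e / (2 * (K + 1)))"] conjI allI impI)
    show "0 < min d (e / (2 * (K + 1)))"
      using \<open>e > 0\<close> \<open>0 \<le> K\<close> \<open>d > 0\<close> by simp
    fix u :: 'a assume u: "norm u < min d (e / (2 * (K + 1)))"
    then have "(K + 1) * norm u \<le> e / 2"
      using \<open>0 \<le> K\<close> by (simp add: field_simps)
    then have "K * norm u \<le> e / 2"
      using norm_ge_zero[of u] unfolding distrib_right by linarith
    then have "K * norm u * norm u \<le> e / 2 * norm u"
      by (intro mult_right_mono) auto
    then show "h (x + u) \<le> h x + \<xi> \<bullet> u + e * norm u"
      using le[of u] d[of u] u \<open>h x = g x\<close> by (simp add: power2_eq_square mult.assoc)
  qed
qed

text \<open>Midpoint convexity between \<open>x + u\<close> and \<open>x - u\<close> turns the upper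
  bound at \<open>x - u\<close> into the missing lower bound at \<open>x + u\<close>.\<close>

lemma convex_supergradient_GDERIV:
  fixes F :: "'a::euclidean_space \<Rightarrow> real"
  assumes cvx: "convex_on UNIV F" and sg: "has_supergradient F \<xi> x"
  shows "GDERIV F x :> \<xi>"
  unfolding gderiv_def has_derivative_at_alt
proof (intro conjI allI impI)
  show "bounded_linear (\<lambda>h. h \<bullet> \<xi>)"
    by (rule bounded_linear_inner_left)
  fix e :: real assume "e > 0"
  then obtain d where "d > 0"
    and d: "\<And>u. norm u < d \<Longrightarrow> F (x + u) \<le> F x + \<xi> \<bullet> u + e * norm u"
    using sg unfolding has_supergradient_def by meson
  show "\<exists>d>0. \<forall>y. norm (y - x) < d \<longrightarrow> norm (F y - F x - (y - x) \<bullet> \<xi>) \<le> e * norm (y - x)"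
  proof (intro exI[of _ d] conjI allI impI \<open>d > 0\<close>)
    fix y assume y: "norm (y - x) < d"
    define u where "u = y - x"
    have "F ((1 - 1/2) *\<^sub>R (x + u) + (1/2) *\<^sub>R (x - u)) \<le> (1 - 1/2) * F (x + u) + 1/2 * F (x - u)"
      by (intro convex_onD[OF cvx]) auto
    moreover have "(1 - 1/2) *\<^sub>R (x + u) + (1/2) *\<^sub>R (x - u) = x"
      by (simp add: algebra_simps flip: scaleR_add_left)
    ultimately have "2 * F x \<le> F (x + u) + F (x - u)"
      by simp
    moreover have "F (x + u) \<le> F x + \<xi> \<bullet> u + e * norm u"
      using d[of u] y u_def by simp
    moreover have "F (x - u) \<le> F x - \<xi> \<bullet> u + e * norm u"
      using d[of "-u"] y u_def[symmetric] by simp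
    ultimately show "norm (F y - F x - (y - x) \<bullet> \<xi>) \<le> e * norm (y - x)"
      unfolding u_def[symmetric] by (simp add: u_def inner_commute)
  qed
qed

text \<open>Convexity on the segment from \<open>x\<close> to \<open>y\<close> bounds the difference
  quotient at a small \<open>t\<close> by \<open>F y - F x\<close>. The summand 1 in
  \<open>norm u + 1\<close> covers \<open>y = x\<close>.\<close>

lemma convex_GDERIV_subgradient:
  fixes F :: "'a::euclidean_space \<Rightarrow> real"
  assumes cvx: "convex_on UNIV F" and D: "GDERIV F x :> \<xi>"
  shows "F y \<ge> F x + \<xi> \<bullet> (y - x)"
proof (rule field_le_epsilon)
  fix e :: real assume "e > 0"
  define u where "u = y - x"
  define e' where "e' = e / (norm u + 1)"
  have "e' > 0"
    using \<open>e > 0\<close> by (simp add: e'_def add_nonneg_pos)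
  then obtain d where "d > 0"
    and d: "\<And>z. norm (z - x) < d \<Longrightarrow> norm (F z - F x - (z - x) \<bullet> \<xi>) \<le> e' * norm (z - x)"
    using D unfolding gderiv_def has_derivative_at_alt by meson
  define t where "t = min 1 (d / (2 * (norm u + 1)))"
  have nu: "norm u + 1 > 0"
    by (simp add: add_nonneg_pos)
  then have t: "0 < t" "t \<le> 1"
    using \<open>d > 0\<close> by (auto simp: t_def)
  have "t * (norm u + 1) \<le> d / (2 * (norm u + 1)) * (norm u + 1)"
    using nu by (intro mult_right_mono) (auto simp: t_def)
  also have "\<dots> = d / 2"
    using nu by (metis divide_divide_eq_left nonzero_eq_divide_eq less_irrefl)
  finally have "t * (norm u + 1) \<le> d / 2" .
  then have "norm (t *\<^sub>R u) < d"
    using t \<open>d > 0\<close> by (simp add: algebra_simps)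
  then have "\<bar>F (x + t *\<^sub>R u) - F x - t * (\<xi> \<bullet> u)\<bar> \<le> e' * (t * norm u)"
    using d[of "x + t *\<^sub>R u"] t by (simp add: inner_commute)
  moreover have "F ((1 - t) *\<^sub>R x + t *\<^sub>R y) \<le> (1 - t) * F x + t * F y"
    using t by (intro convex_onD[OF cvx]) auto
  moreover have "(1 - t) *\<^sub>R x + t *\<^sub>R y = x + t *\<^sub>R u"
    by (simp add: u_def algebra_simps)
  ultimately have "t * (F x + \<xi> \<bullet> u) \<le> t * (F y + e' * norm u)"
    by (simp add: algebra_simps)
  then have "F x + \<xi> \<bullet> u \<le> F y + e' * norm u"
    using t by simp
  also have "e' * norm u \<le> e"
    using \<open>e > 0\<close> nu by (simp add: e'_def field_simps)
  finally show "F x + \<xi> \<bullet> (y - x) \<le> F y + e"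
    by (simp add: u_def)
qed

text \<open>A small step in the direction \<open>\<eta> - \<xi>\<close> raises the lower bound over
  \<open>\<xi>\<close> by the full \<open>norm (\<eta> - \<xi>) * norm u\<close>, while the
  supergradient can be made to allow only half of that.\<close>

lemma supergradient_subgradient_unique:
  fixes F :: "'a::euclidean_space \<Rightarrow> real"
  assumes sg: "has_supergradient F \<xi> x" and sub: "\<And>y. F y \<ge> F x + \<eta> \<bullet> (y - x)"
  shows "\<eta> = \<xi>"
proof (rule ccontr)
  assume "\<eta> \<noteq> \<xi>"
  then have n: "norm (\<eta> - \<xi>) > 0"
    by simp
  then obtain d where "d > 0"
    and d: "\<And>u. norm u < d \<Longrightarrow> F (x + u) \<le> F x + \<xi> \<bullet> u + norm (\<eta> - \<xi>) / 2 * norm u"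
    using sg unfolding has_supergradient_def by (meson half_gt_zero)
  define t where "t = d / (2 * norm (\<eta> - \<xi>))"
  have t: "t > 0"
    using n \<open>d > 0\<close> by (simp add: t_def)
  define u where "u = t *\<^sub>R (\<eta> - \<xi>)"
  have nu: "norm u = t * norm (\<eta> - \<xi>)"
    using t by (simp add: u_def)
  have "norm u < d"
    using n \<open>d > 0\<close> by (simp add: nu t_def)
  from d[OF this] have "(\<eta> - \<xi>) \<bullet> u \<le> norm (\<eta> - \<xi>) / 2 * norm u"
    using sub[of "x + u"] by (simp add: inner_diff_left)
  then have "t * ((\<eta> - \<xi>) \<bullet> (\<eta> - \<xi>)) \<le> t * (norm (\<eta> - \<xi>) / 2 * norm (\<eta> - \<xi>))"
    unfolding nu by (simp add: u_def mult_ac)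
  then have "norm (\<eta> - \<xi>) * norm (\<eta> - \<xi>) \<le> norm (\<eta> - \<xi>) / 2 * norm (\<eta> - \<xi>)"
    using t by (simp add: dot_square_norm power2_eq_square)
  then show False
    using mult_pos_pos[OF n n] by simp
qed

text \<open>Testing the subgradient inequality at \<open>x + \<xi>\<close> gives the bound if
  \<open>\<xi>\<close> is nonzero. For \<open>\<xi> = 0\<close> the claim is
  \<open>0 \<le> L\<close>, which a test point at distance one from \<open>x\<close>
  supplies.\<close>

lemma GDERIV_norm_le_lipschitz:
  fixes F :: "'a::euclidean_space \<Rightarrow> real"
  assumes cvx: "convex_on UNIV F" and D: "GDERIV F x :> \<xi>"
    and lip: "\<And>y. F y \<le> F x + L * norm (y - x)"
  shows "norm \<xi> \<le> L"
proof (cases "\<xi> = 0")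
  case True
  have "0 \<le> L * norm (y - x)" for y
    using convex_GDERIV_subgradient[OF cvx D, of y] lip[of y] True by simp
  then have "0 \<le> L * norm ((x + (SOME b. b \<in> Basis)) - x)"
    by blast
  then show ?thesis
    using True by (simp add: SOME_Basis)
next
  case False
  have "\<xi> \<bullet> \<xi> \<le> L * norm \<xi>"
    using convex_GDERIV_subgradient[OF cvx D, of "x + \<xi>"] lip[of "x + \<xi>"] by simp
  then show ?thesis
    using False by (simp add: dot_square_norm power2_eq_square)
qed

text \<open>The graph of \<open>DF\<close> is the subdifferential relation, an intersection of
  closed conditions, and \<open>DF\<close> takes values in a compact ball; a closed graph over a
  compact range gives continuity.\<close>

lemma continuous_on_gradient_convex:
  fixes F :: "'a::euclidean_space \<Rightarrow> real"
  assumes cvx: "convex_on UNIV F"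
    and sg: "\<And>x. has_supergradient F (DF x) x"
    and lip: "\<And>x y. F y \<le> F x + L * norm (y - x)"
  shows "continuous_on UNIV DF"
proof -
  have D: "GDERIV F x :> DF x" for x
    using convex_supergradient_GDERIV[OF cvx sg] .
  have cont: "continuous_on UNIV F"
    using D unfolding gderiv_def
    by (meson continuous_at_imp_continuous_on has_derivative_continuous)
  have "closed {p. \<forall>y. F y \<ge> F (fst p) + snd p \<bullet> (y - fst p)}"
    by (intro closed_Collect_all closed_Collect_le continuous_intros
        continuous_on_compose2[OF cont]) auto
  moreover have "{p. \<forall>y. F y \<ge> F (fst p) + snd p \<bullet> (y - fst p)} = (\<lambda>x. (x, DF x)) ` UNIV"
    using supergradient_subgradient_unique[OF sg] convex_GDERIV_subgradient[OF cvx D]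
    by (auto simp: image_iff)
  moreover have "compact (cball (0::'a) L)" "DF \<in> UNIV \<rightarrow> cball 0 L"
    using GDERIV_norm_le_lipschitz[OF cvx D lip] by auto
  ultimately show ?thesis
    by (intro continuous_from_closed_graph) auto
qed

section \<open>Convex envelopes\<close>

text \<open>The heights over \<open>x\<close> in the hull need not attain their infimum. The value
  is meaningful when \<open>h\<close> has a convex minorant, which keeps these heights bounded
  below.\<close>

definition convex_envelope :: "('a::euclidean_space \<Rightarrow> real) \<Rightarrow> 'a \<Rightarrow> real"
  where "convex_envelope h x = Inf {t. (x, t) \<in> convex hull epigraph UNIV h}"

locale convex_minorant =
  fixes h m :: "'a::euclidean_space \<Rightarrow> real"
  assumes convex_m: "convex_on UNIV m" and m_le: "\<And>x. m x \<le> h x"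
begin

lemma hull_epigraph_above: "(x, t) \<in> convex hull epigraph UNIV h \<Longrightarrow> m x \<le> t"
proof -
  have *: "epigraph UNIV h \<subseteq> epigraph UNIV m"
    by (auto simp: epigraph_def intro: order_trans[OF m_le])
  have "convex hull epigraph UNIV h \<subseteq> epigraph UNIV m"
    using convex_m by (intro hull_minimal *) (simp add: convex_epigraph)
  then show "(x, t) \<in> convex hull epigraph UNIV h \<Longrightarrow> m x \<le> t"
    by (auto simp: mem_epigraph)
qed

lemma graph_in_hull: "(x, h x) \<in> convex hull epigraph UNIV h"
  by (intro hull_inc) (simp add: mem_epigraph)

lemma convex_envelope_lower:
  assumes "(x, t) \<in> convex hull epigraph UNIV h"
  shows "convex_envelope h x \<le> t"
  unfolding convex_envelope_def using assms hull_epigraph_above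
  by (intro cInf_lower bdd_belowI[of _ "m x"]) auto

lemma convex_envelope_greatest:
  assumes "\<And>t. (x, t) \<in> convex hull epigraph UNIV h \<Longrightarrow> b \<le> t"
  shows "b \<le> convex_envelope h x"
  unfolding convex_envelope_def using assms graph_in_hull
  by (intro cInf_greatest) auto

lemma convex_envelope_le: "convex_envelope h x \<le> h x"
  by (rule convex_envelope_lower[OF graph_in_hull])

lemma convex_envelope_ge: "m x \<le> convex_envelope h x"
  by (rule convex_envelope_greatest[OF hull_epigraph_above])

lemma convex_envelope_near:
  assumes "e > 0"
  obtains t where "(x, t) \<in> convex hull epigraph UNIV h" "t < convex_envelope h x + e"
proof -
  have "\<not> (\<forall>t. (x, t) \<in> convex hull epigraph UNIV h \<longrightarrow> convex_envelope h x + e \<le> t)"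
    using convex_envelope_greatest[of x "convex_envelope h x + e"] assms by auto
  then show ?thesis
    using that by (meson not_less)
qed

lemma convex_convex_envelope: "convex_on UNIV (convex_envelope h)"
proof (rule convex_onI)
  fix t :: real and x y :: 'a
  assume t: "0 < t" "t < 1"
  show "convex_envelope h ((1 - t) *\<^sub>R x + t *\<^sub>R y)
      \<le> (1 - t) * convex_envelope h x + t * convex_envelope h y"
  proof (rule field_le_epsilon)
    fix e :: real assume "e > 0"
    obtain a where a: "(x, a) \<in> convex hull epigraph UNIV h" "a < convex_envelope h x + e"
      using convex_envelope_near[OF \<open>e > 0\<close>] .
    obtain b where b: "(y, b) \<in> convex hull epigraph UNIV h" "b < convex_envelope h y + e"
      using convex_envelope_near[OF \<open>e > 0\<close>] .
    have "(1 - t) *\<^sub>R (x, a) + t *\<^sub>R (y, b) \<in> convex hull epigraph UNIV h"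
      using t a b by (intro convexD[OF convex_convex_hull]) auto
    then have "convex_envelope h ((1 - t) *\<^sub>R x + t *\<^sub>R y) \<le> (1 - t) * a + t * b"
      by (intro convex_envelope_lower) simp
    also have "\<dots> \<le> (1 - t) * (convex_envelope h x + e) + t * (convex_envelope h y + e)"
      using t a b by (intro add_mono mult_left_mono) auto
    also have "\<dots> = (1 - t) * convex_envelope h x + t * convex_envelope h y + e"
      by (simp add: algebra_simps)
    finally show "convex_envelope h ((1 - t) *\<^sub>R x + t *\<^sub>R y)
        \<le> (1 - t) * convex_envelope h x + t * convex_envelope h y + e" .
  qed
qed simp

text \<open>Translation by \<open>(u, c)\<close> maps the epigraph into itself, hence also its
  convex hull. With \<open>c = M * norm u\<close> this yields Lipschitz bounds, with
  \<open>c = v \<bullet> u\<close> linearity along a subspace.\<close>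

lemma convex_envelope_shift_le:
  assumes "\<And>x. h (x + u) \<le> h x + c"
  shows "convex_envelope h (x + u) \<le> convex_envelope h x + c"
proof -
  have "convex_envelope h (x + u) - c \<le> t" if t: "(x, t) \<in> convex hull epigraph UNIV h" for t
  proof -
    have "(+) (u, c) ` epigraph UNIV h \<subseteq> epigraph UNIV h"
    proof (clarsimp simp: mem_epigraph)
      fix y s assume "h y \<le> s"
      then show "h (u + y) \<le> c + s"
        using assms[of y] by (simp add: add.commute)
    qed
    then have "convex hull ((+) (u, c) ` epigraph UNIV h) \<subseteq> convex hull epigraph UNIV h"
      by (rule hull_mono)
    moreover have "(u, c) + (x, t) \<in> (+) (u, c) ` (convex hull epigraph UNIV h)"
      using t by (rule imageI)
    ultimately have "(u, c) + (x, t) \<in> convex hull epigraph UNIV h"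
      by (auto simp only: convex_hull_translation)
    then have "(x + u, t + c) \<in> convex hull epigraph UNIV h"
      by (simp add: add.commute)
    then show ?thesis
      using convex_envelope_lower[of "x + u" "t + c"] by simp
  qed
  then have "convex_envelope h (x + u) - c \<le> convex_envelope h x"
    by (rule convex_envelope_greatest)
  then show ?thesis
    by simp
qed

end

text \<open>Perturbing only one point of a Caratheodory representation of \<open>(x, t)\<close>, one whose weight is
  bounded below. Neither the infimum in the envelope nor a limit of the whole representation has to
  be attained: the points of small weight may escape to infinity.\<close>

lemma convex_hull_epigraph_transport:
  fixes h \<rho> :: "'a::euclidean_space \<Rightarrow> real" and C D :: real
  assumes hull: "(x, t) \<in> convex hull epigraph UNIV h"
    and low: "\<And>y. \<rho> y \<le> h y - v \<bullet> y + C" and \<rho>: "\<And>y. 0 \<le> \<rho> y"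
    and D: "t - v \<bullet> x + C \<le> D"
  obtains \<theta> y where "1 / (DIM('a) + 2) \<le> \<theta>" "\<theta> \<le> 1" "\<rho> y \<le> D * (DIM('a) + 2)"
    "\<And>u. (x + u, t + \<theta> * (h (y + u /\<^sub>R \<theta>) - h y)) \<in> convex hull epigraph UNIV h"
proof -
  define N where "N = real (DIM('a) + 2)"
  have N: "N > 0"
    by (simp add: N_def)
  obtain S where S: "finite S" "S \<subseteq> epigraph UNIV h" "card S \<le> DIM('a \<times> real) + 1"
    "(x, t) \<in> convex hull S"
    using hull unfolding caratheodory[of "epigraph UNIV h"] by blast
  obtain \<mu> where \<mu>: "\<And>p. p \<in> S \<Longrightarrow> 0 \<le> \<mu> p" "sum \<mu> S = 1" "(\<Sum>p\<in>S. \<mu> p *\<^sub>R p) = (x, t)"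
    using S(4) unfolding convex_hull_finite[OF S(1)] by blast
  \<comment> \<open>Caratheodory in dimension \<open>DIM('a) + 1\<close> leaves at most
    \<open>N\<close> points, whose weights sum to one.\<close>
  have "\<exists>p\<in>S. 1 / N \<le> \<mu> p"
  proof (rule ccontr)
    assume neg: "\<not> (\<exists>p\<in>S. 1 / N \<le> \<mu> p)"
    have "S \<noteq> {}"
      using \<mu>(2) by auto
    then have "sum \<mu> S < (\<Sum>p\<in>S. 1 / N)"
      using neg S(1) by (intro sum_strict_mono) auto
    also have "\<dots> = card S / N"
      by simp
    also have "\<dots> \<le> 1"
      using S(3) N by (simp add: N_def)
    finally show False
      using \<mu>(2) by simp
  qed
  then obtain p where p: "p \<in> S" "1 / N \<le> \<mu> p"
    by blast
  define \<theta> where "\<theta> = \<mu> p"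
  define y where "y = fst p"
  have pos: "\<theta> > 0"
    using p(2) N less_le_trans[of 0 "1 / N" \<theta>] by (simp add: \<theta>_def)
  have le1: "\<theta> \<le> 1"
    using member_le_sum[of p S \<mu>] \<mu> S(1) p(1) by (simp add: \<theta>_def)
  \<comment> \<open>An affine function on the product space: its \<open>\<mu>\<close>-average is its
    value at \<open>(x, t)\<close>, at most \<open>D\<close>. As it is nonnegative on
    \<open>S\<close>, the single term of \<open>p\<close> is at most \<open>D\<close> too.\<close>
  define \<phi> where "\<phi> q = snd q - v \<bullet> fst q + C" for q :: "'a \<times> real"
  have \<phi>: "\<rho> (fst q) \<le> \<phi> q" if "q \<in> S" for q
    using S(2) that low[of "fst q"] by (auto simp: \<phi>_def epigraph_def)
  have \<phi>0: "0 \<le> \<phi> q" if "q \<in> S" for q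
    using \<phi>[OF that] \<rho>[of "fst q"] by linarith
  have "(\<Sum>q\<in>S. \<mu> q * \<phi> q) = snd (\<Sum>q\<in>S. \<mu> q *\<^sub>R q) - v \<bullet> fst (\<Sum>q\<in>S. \<mu> q *\<^sub>R q) + C * sum \<mu> S"
    by (simp add: \<phi>_def fst_sum snd_sum inner_sum_right sum_distrib_left sum.distrib
        sum_subtractf algebra_simps)
  also have "\<dots> = t - v \<bullet> x + C"
    by (simp add: \<mu>)
  finally have "(\<Sum>q\<in>S. \<mu> q * \<phi> q) \<le> D"
    using D by simp
  moreover have "\<mu> p * \<phi> p \<le> (\<Sum>q\<in>S. \<mu> q * \<phi> q)"
    using S(1) p(1) \<mu>(1) \<phi>0 by (intro member_le_sum) auto
  ultimately have "\<theta> * \<phi> p \<le> D"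
    by (simp add: \<theta>_def)
  moreover have "1 / N * \<phi> p \<le> \<theta> * \<phi> p"
    using p(2) \<phi>0[OF p(1)] by (intro mult_right_mono) (auto simp: \<theta>_def)
  ultimately have "1 / N * \<phi> p \<le> D"
    by (rule order_trans[rotated])
  then have "\<phi> p \<le> D * N"
    using N by (simp add: field_simps)
  then have bound: "\<rho> y \<le> D * N"
    using \<phi>[OF p(1)] by (simp add: y_def)
  have move: "(x + u, t + \<theta> * (h (y + u /\<^sub>R \<theta>) - h y)) \<in> convex hull epigraph UNIV h" for u
  proof -
    \<comment> \<open>Moving \<open>p\<close> alone by \<open>s\<close> moves the barycentre by
      \<open>\<theta> *\<^sub>R s\<close>. The moved point stays in the epigraph because its height
      changes exactly by the increment of \<open>h\<close>.\<close>
    define s where "s = (u /\<^sub>R \<theta>, h (y + u /\<^sub>R \<theta>) - h y)"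
    define f where "f q = (if q = p then q + s else q)" for q
    have "f q \<in> convex hull epigraph UNIV h" if "q \<in> S" for q
      using S(2) that by (intro hull_inc) (auto simp: f_def s_def y_def epigraph_def)
    then have "(\<Sum>q\<in>S. \<mu> q *\<^sub>R f q) \<in> convex hull epigraph UNIV h"
      using S(1) \<mu> by (intro convex_sum convex_convex_hull) auto
    also have "(\<Sum>q\<in>S. \<mu> q *\<^sub>R f q) = (\<Sum>q\<in>S. \<mu> q *\<^sub>R q + (if q = p then \<mu> p *\<^sub>R s else 0))"
      by (intro sum.cong) (auto simp: f_def scaleR_add_right)
    also have "\<dots> = (x, t) + \<theta> *\<^sub>R s"
      using S(1) p(1) by (simp add: sum.distrib \<mu> \<theta>_def)
    also have "\<dots> = (x + u, t + \<theta> * (h (y + u /\<^sub>R \<theta>) - h y))"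
      using pos by (simp add: s_def)
    finally show ?thesis .
  qed
  show ?thesis
    using that[OF _ le1 _ move] p(2) bound by (simp add: \<theta>_def N_def)
qed

text \<open>Transport from heights ever closer to the envelope bounds \<open>F (x + u)\<close> by
  rescaled increments of \<open>h\<close> at base points. Coercivity on \<open>X\<close> and
  invariance along its complement confine these points to a compact set. In the limit
  \<open>F (x + u) \<le> F x + L * (h (Z + u /\<^sub>R L) - h Z)\<close>, so a supergradient of
  \<open>h\<close> at \<open>Z\<close> serves for \<open>F\<close> at \<open>x\<close>.\<close>

lemma has_supergradient_convex_envelope:
  fixes h m :: "'a::euclidean_space \<Rightarrow> real"
  assumes "convex_minorant h m"
    and cont: "continuous_on UNIV h"
    and X: "subspace X"
    and shift: "\<And>x w. w \<in> X\<^sup>\<bottom> \<Longrightarrow> h (x + w) = h x + v \<bullet> w"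
    and "0 < r" and low: "\<And>x. r * norm (orth_proj X x) - C \<le> h x - v \<bullet> x"
    and sg: "\<And>x. \<exists>\<xi>. has_supergradient h \<xi> x"
  shows "\<exists>\<xi>. has_supergradient (convex_envelope h) \<xi> x"
proof -
  interpret convex_minorant h m
    by fact
  define F where "F = convex_envelope h"
  define N where "N = real (DIM('a) + 2)"
  \<comment> \<open>The summand 1 dominates every slack \<open>1 / Suc n\<close>, so one bound
    serves all \<open>n\<close>.\<close>
  define D where "D = F x + 1 - v \<bullet> x + C"
  have "\<exists>t \<theta> y. t < F x + 1 / Suc n \<and> 1 / N \<le> \<theta> \<and> \<theta> \<le> 1 \<and> r * norm (orth_proj X y) \<le> D * N
      \<and> (\<forall>u. F (x + u) \<le> t + \<theta> * (h (y + u /\<^sub>R \<theta>) - h y))" for n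
  proof -
    obtain t where t: "(x, t) \<in> convex hull epigraph UNIV h" "t < F x + 1 / Suc n"
      using convex_envelope_near[of "1 / Suc n" x] by (auto simp: F_def)
    have "1 / Suc n \<le> (1::real)"
      by simp
    then have "t - v \<bullet> x + C \<le> D"
      using t(2) unfolding D_def by linarith
    moreover have "r * norm (orth_proj X y) \<le> h y - v \<bullet> y + C" for y
      using low[of y] by simp
    moreover have "0 \<le> r * norm (orth_proj X y)" for y
      using \<open>0 < r\<close> by simp
    ultimately obtain \<theta> y where "1 / N \<le> \<theta>" "\<theta> \<le> 1"
      "r * norm (orth_proj X y) \<le> D * N"
      and move: "\<And>u. (x + u, t + \<theta> * (h (y + u /\<^sub>R \<theta>) - h y)) \<in> convex hull epigraph UNIV h"
      unfolding N_def
      using convex_hull_epigraph_transport[OF t(1), of "\<lambda>y. r * norm (orth_proj X y)" v C D]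
      by blast
    moreover have "F (x + u) \<le> t + \<theta> * (h (y + u /\<^sub>R \<theta>) - h y)" for u
      unfolding F_def by (rule convex_envelope_lower[OF move])
    ultimately show ?thesis
      using t(2) by blast
  qed
  then obtain t \<theta> y where t: "\<And>n. t n < F x + 1 / Suc n"
    and \<theta>: "\<And>n. 1 / N \<le> \<theta> n" "\<And>n. \<theta> n \<le> 1"
    and y: "\<And>n. r * norm (orth_proj X (y n)) \<le> D * N"
    and F: "\<And>n u. F (x + u) \<le> t n + \<theta> n * (h (y n + u /\<^sub>R \<theta> n) - h (y n))"
    by metis
  define z where "z n = orth_proj X (y n)" for n
  \<comment> \<open>Increments of \<open>h\<close> do not change when the base point is shifted
    orthogonally to \<open>X\<close>, so \<open>y n\<close> may be replaced by its bounded
    projection.\<close>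
  have Fz: "F (x + u) \<le> F x + 1 / Suc n + \<theta> n * (h (z n + u /\<^sub>R \<theta> n) - h (z n))" for n u
  proof -
    define w where "w = y n - z n"
    have w: "w \<in> X\<^sup>\<bottom>"
      by (simp add: w_def z_def orth_proj_props X)
    have "h (y n + u /\<^sub>R \<theta> n) = h (z n + u /\<^sub>R \<theta> n + w)" "h (y n) = h (z n + w)"
      by (simp_all add: w_def algebra_simps)
    then have "h (y n + u /\<^sub>R \<theta> n) - h (y n) = h (z n + u /\<^sub>R \<theta> n) - h (z n)"
      using shift[OF w] by simp
    then show ?thesis
      using F[of u n] t[of n] by simp
  qed
  have "\<And>n. (\<theta> n, z n) \<in> {1 / N..1} \<times> cball 0 (D * N / r)"
    using \<theta> y \<open>0 < r\<close> by (auto simp: z_def field_simps)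
  moreover have "compact ({1 / N..1} \<times> cball (0::'a) (D * N / r))"
    by (intro compact_Times compact_Icc compact_cball)
  ultimately obtain l \<sigma> where l: "l \<in> {1 / N..1} \<times> cball (0::'a) (D * N / r)"
    and \<sigma>: "strict_mono \<sigma>" "((\<lambda>n. (\<theta> n, z n)) \<circ> \<sigma>) \<longlonglongrightarrow> l"
    using seq_compactE[OF compact_imp_seq_compact, of _ "\<lambda>n. (\<theta> n, z n)"] by blast
  define L where "L = fst l"
  define Z where "Z = snd l"
  have L: "L > 0"
    using l less_le_trans[of 0 "1 / N" L] by (auto simp: L_def N_def)
  have lim: "(\<lambda>n. \<theta> (\<sigma> n)) \<longlonglongrightarrow> L" "(\<lambda>n. z (\<sigma> n)) \<longlonglongrightarrow> Z"
    using tendsto_fst[OF \<sigma>(2)] tendsto_snd[OF \<sigma>(2)] by (simp_all add: L_def Z_def o_def)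
  have FZ: "F (x + u) \<le> F x + L * (h (Z + u /\<^sub>R L) - h Z)" for u
  proof (rule LIMSEQ_le_const)
    have *: "(\<lambda>n. h (a n)) \<longlonglongrightarrow> h A" if "a \<longlonglongrightarrow> A" for a A
      using cont that by (auto simp: continuous_on_eq_continuous_at isCont_tendsto_compose)
    have "(\<lambda>n. 1 / real (Suc (\<sigma> n))) \<longlonglongrightarrow> 0"
      using LIMSEQ_subseq_LIMSEQ[OF LIMSEQ_inverse_real_of_nat \<sigma>(1)]
      by (simp add: o_def inverse_eq_divide)
    then have "(\<lambda>n. F x + 1 / Suc (\<sigma> n) + \<theta> (\<sigma> n) * (h (z (\<sigma> n) + u /\<^sub>R \<theta> (\<sigma> n)) - h (z (\<sigma> n))))
        \<longlonglongrightarrow> F x + 0 + L * (h (Z + u /\<^sub>R L) - h Z)"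
      using L by (intro tendsto_intros * lim) auto
    then show "(\<lambda>n. F x + 1 / Suc (\<sigma> n) + \<theta> (\<sigma> n) * (h (z (\<sigma> n) + u /\<^sub>R \<theta> (\<sigma> n)) - h (z (\<sigma> n))))
        \<longlonglongrightarrow> F x + L * (h (Z + u /\<^sub>R L) - h Z)"
      by simp
    show "\<exists>k. \<forall>n\<ge>k. F (x + u)
        \<le> F x + 1 / Suc (\<sigma> n) + \<theta> (\<sigma> n) * (h (z (\<sigma> n) + u /\<^sub>R \<theta> (\<sigma> n)) - h (z (\<sigma> n)))"
      using Fz by blast
  qed
  obtain \<xi> where \<xi>: "has_supergradient h \<xi> Z"
    using sg by blast
  have "has_supergradient F \<xi> x"
    unfolding has_supergradient_def
  proof (intro allI impI)
    fix e :: real assume "e > 0"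
    then obtain d where "d > 0"
      and d: "\<And>u. norm u < d \<Longrightarrow> h (Z + u) \<le> h Z + \<xi> \<bullet> u + e * norm u"
      using \<xi> unfolding has_supergradient_def by meson
    show "\<exists>d>0. \<forall>u. norm u < d \<longrightarrow> F (x + u) \<le> F x + \<xi> \<bullet> u + e * norm u"
    proof (intro exI[of _ "d * L"] conjI allI impI)
      show "0 < d * L"
        using \<open>d > 0\<close> L by simp
      fix u :: 'a assume "norm u < d * L"
      then have "norm (u /\<^sub>R L) < d"
        using L by (simp add: field_simps)
      from d[OF this] have "L * (h (Z + u /\<^sub>R L) - h Z) \<le> L * (\<xi> \<bullet> (u /\<^sub>R L) + e * norm (u /\<^sub>R L))"
        using L by (intro mult_left_mono) auto
      also have "\<dots> = \<xi> \<bullet> u + e * norm u"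
        using L by (simp add: field_simps)
      finally show "F (x + u) \<le> F x + \<xi> \<bullet> u + e * norm u"
        using FZ[of u] by simp
    qed
  qed
  then show ?thesis
    unfolding F_def by blast
qed

section \<open>Infima of smoothed cones\<close>

text \<open>The square makes the width vanish to second order on \<open>K\<close>, so that
  supergradients survive there, while it stays positive off a closed \<open>K\<close>.\<close>

definition apex_width :: "'a::euclidean_space set \<Rightarrow> 'a \<Rightarrow> real"
  where "apex_width K z = (infdist z K)\<^sup>2"

text \<open>The Lipschitz regularization of \<open>m\<close> (infimal convolution with
  \<open>M\<close> times the norm), with each cone rounded at its apex to a hyperboloid on the scale
  \<open>apex_width K z\<close>.\<close>

definition cone_envelope :: "('a::euclidean_space \<Rightarrow> real) \<Rightarrow> real \<Rightarrow> 'a set \<Rightarrow> 'a \<Rightarrow> real"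
  where "cone_envelope m M K x
    = (INF z. m z + M * sqrt ((norm (x - z))\<^sup>2 + (apex_width K z)\<^sup>2))"

text \<open>The concave square root lies below its tangent at \<open>s * s\<close>; after squaring,
  the difference is \<open>(c / (2 * s))\<^sup>2\<close>.\<close>

lemma sqrt_add_le:
  assumes "0 < s" "0 \<le> s * s + c"
  shows "sqrt (s * s + c) \<le> s + c / (2 * s)"
proof (rule real_le_lsqrt)
  have "0 \<le> s * s + (s * s + c)"
    using assms(2) zero_le_square[of s] by linarith
  then have "0 \<le> (s * s + (s * s + c)) / (2 * s)"
    using assms(1) by simp
  also have "\<dots> = s + c / (2 * s)"
    using assms by (simp add: field_simps)
  finally show "0 \<le> s + c / (2 * s)" .
  have "s * s + c \<le> s * s + c + (c / (2 * s))\<^sup>2"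
    by simp
  also have "\<dots> = (s + c / (2 * s))\<^sup>2"
    using assms by (simp add: power2_eq_square field_simps)
  finally show "s * s + c \<le> (s + c / (2 * s))\<^sup>2" .
qed

locale lipschitz_with_contact_set =
  fixes m :: "'a::euclidean_space \<Rightarrow> real" and M :: real and K :: "'a set"
  assumes M: "0 \<le> M" and lip: "\<And>x y. m y \<le> m x + M * norm (y - x)"
    and K: "closed K" "K \<noteq> {}"
begin

abbreviation smoothed_cone :: "'a \<Rightarrow> 'a \<Rightarrow> real"
  where "smoothed_cone z x \<equiv> m z + M * sqrt ((norm (x - z))\<^sup>2 + (apex_width K z)\<^sup>2)"

lemma cone_ge: "m x \<le> smoothed_cone z x"
proof -
  have "norm (x - z) \<le> sqrt ((norm (x - z))\<^sup>2 + (apex_width K z)\<^sup>2)"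
    by (rule real_le_rsqrt) simp
  then have "M * norm (x - z) \<le> M * sqrt ((norm (x - z))\<^sup>2 + (apex_width K z)\<^sup>2)"
    using M by (rule mult_left_mono)
  then show ?thesis
    using lip[of x z] by linarith
qed

lemma cone_envelope_le_cone: "cone_envelope m M K x \<le> smoothed_cone z x"
  unfolding cone_envelope_def using cone_ge by (intro cINF_lower bdd_belowI[of _ "m x"]) auto

lemma cone_envelope_greatest: "(\<And>z. b \<le> smoothed_cone z x) \<Longrightarrow> b \<le> cone_envelope m M K x"
  unfolding cone_envelope_def by (intro cINF_greatest) auto

lemma cone_envelope_ge: "m x \<le> cone_envelope m M K x"
  by (intro cone_envelope_greatest cone_ge)

text \<open>The cone with apex at \<open>x\<close> itself has this value at
  \<open>x\<close>.\<close>

lemma cone_envelope_le: "cone_envelope m M K x \<le> m x + M * (infdist x K)\<^sup>2"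
  using cone_envelope_le_cone[of x x] real_sqrt_abs[of "apex_width K x"]
  by (simp add: abs_of_nonneg) (simp add: apex_width_def)

lemma cone_envelope_eq: "x \<in> K \<Longrightarrow> cone_envelope m M K x = m x"
  using cone_envelope_le[of x] cone_envelope_ge[of x] by simp

text \<open>The root is the Euclidean norm of the pair of distance and width, so each cone is
  \<open>M\<close>-Lipschitz by the triangle inequality in the plane, and infima preserve
  this.\<close>

lemma cone_envelope_lipschitz: "cone_envelope m M K (x + u) \<le> cone_envelope m M K x + M * norm u"
proof -
  have "cone_envelope m M K (x + u) - M * norm u \<le> smoothed_cone z x" for z
  proof -
    have "sqrt ((norm (x + u - z))\<^sup>2 + (apex_width K z)\<^sup>2)
        \<le> sqrt ((norm (x - z) + norm u)\<^sup>2 + (apex_width K z + 0)\<^sup>2)"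
      using norm_triangle_ineq[of "x - z" u]
      by (auto intro!: power_mono simp: algebra_simps)
    also have "\<dots> \<le> sqrt ((norm (x - z))\<^sup>2 + (apex_width K z)\<^sup>2) + sqrt ((norm u)\<^sup>2 + 0\<^sup>2)"
      by (rule real_sqrt_sum_squares_triangle_ineq)
    finally have "M * sqrt ((norm (x + u - z))\<^sup>2 + (apex_width K z)\<^sup>2)
        \<le> M * (sqrt ((norm (x - z))\<^sup>2 + (apex_width K z)\<^sup>2) + norm u)"
      using M by (intro mult_left_mono) simp
    then show ?thesis
      using cone_envelope_le_cone[of "x + u" z] by (simp add: algebra_simps)
  qed
  then have "cone_envelope m M K (x + u) - M * norm u \<le> cone_envelope m M K x"
    by (rule cone_envelope_greatest)
  then show ?thesis
    by simp
qed

text \<open>Invariance of \<open>K\<close> makes the widths invariant, so translating the apex along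
  with the point carries the family of cones onto itself, up to \<open>c\<close>.\<close>

lemma cone_envelope_shift:
  assumes m: "\<And>x. m (x + w) = m x + c" and "(+) w ` K = K"
  shows "cone_envelope m M K (x + w) = cone_envelope m M K x + c"
proof -
  have d: "infdist (z + w) K = infdist z K" for z
  proof -
    have "infdist (z + w) K = infdist (z + w) ((+) w ` K)"
      using assms(2) by simp
    also have "\<dots> = infdist z K"
      by (simp add: infdist_def image_image K dist_norm add.commute)
    finally show ?thesis .
  qed
  have cone: "smoothed_cone (z + w) (x + w) = smoothed_cone z x + c" for z x
    by (simp add: m d apex_width_def)
  have "cone_envelope m M K (x + w) - c \<le> smoothed_cone z x" for z
    using cone_envelope_le_cone[of "x + w" "z + w"] unfolding cone by linarith
  then have "cone_envelope m M K (x + w) - c \<le> cone_envelope m M K x"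
    by (rule cone_envelope_greatest)
  moreover have "cone_envelope m M K x + c \<le> smoothed_cone z (x + w)" for z
    using cone_envelope_le_cone[of x "z - w"] cone[of "z - w" x] unfolding diff_add_cancel
    by linarith
  then have "cone_envelope m M K x + c \<le> cone_envelope m M K (x + w)"
    by (rule cone_envelope_greatest)
  ultimately show ?thesis
    by simp
qed

text \<open>The tangent bound for the square root gives the slope
  \<open>(M / s) *\<^sub>R (x - z)\<close> and a quadratic error with coefficient
  \<open>M / (2 * s)\<close>. Passing to \<open>s0\<close> makes the error uniform over all apexes
  with the same lower bound.\<close>

lemma cone_shift_le:
  assumes "0 < s0" "s0 \<le> sqrt ((norm (x - z))\<^sup>2 + (apex_width K z)\<^sup>2)"
  obtains \<xi> where "norm \<xi> \<le> M"
    "\<And>u. smoothed_cone z (x + u) \<le> smoothed_cone z x + \<xi> \<bullet> u + M / (2 * s0) * (norm u)\<^sup>2"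
proof -
  define s where "s = sqrt ((norm (x - z))\<^sup>2 + (apex_width K z)\<^sup>2)"
  have s: "0 < s" "s0 \<le> s"
    using assms unfolding s_def by linarith+
  have ss: "s * s = (norm (x - z))\<^sup>2 + (apex_width K z)\<^sup>2"
    by (simp add: s_def)
  have ns: "norm (x - z) \<le> s"
    unfolding s_def by (rule real_le_rsqrt) simp
  show ?thesis
  proof
    show "norm ((M / s) *\<^sub>R (x - z)) \<le> M"
      using M s mult_left_mono[OF ns M] by (simp add: pos_divide_le_eq flip: scaleR_diff_right)
    fix u
    define c where "c = 2 * ((x - z) \<bullet> u) + (norm u)\<^sup>2"
    have "(norm (x + u - z))\<^sup>2 = (norm (x - z))\<^sup>2 + c"
      using dot_norm[of "x - z" u] by (simp add: c_def algebra_simps)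
    then have eq: "(norm (x + u - z))\<^sup>2 + (apex_width K z)\<^sup>2 = s * s + c"
      by (simp add: ss)
    have "sqrt (s * s + c) \<le> s + c / (2 * s)"
      using s(1) by (intro sqrt_add_le) (simp_all flip: eq)
    also have "\<dots> = s + (x - z) \<bullet> u / s + 1 / (2 * s) * (norm u)\<^sup>2"
      using s by (simp add: c_def field_simps)
    also have "\<dots> \<le> s + (x - z) \<bullet> u / s + 1 / (2 * s0) * (norm u)\<^sup>2"
      using s assms(1) by (intro add_left_mono mult_right_mono) (auto intro!: divide_left_mono)
    finally have "M * sqrt (s * s + c) \<le> M * (s + (x - z) \<bullet> u / s + 1 / (2 * s0) * (norm u)\<^sup>2)"
      using M by (rule mult_left_mono)
    then have "M * sqrt (s * s + c) \<le> M * s + ((M / s) *\<^sub>R (x - z)) \<bullet> u + M / (2 * s0) * (norm u)\<^sup>2"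
      by (simp add: distrib_left)
    then show "smoothed_cone z (x + u) \<le> smoothed_cone z x + ((M / s) *\<^sub>R (x - z)) \<bullet> u + M / (2 * s0) * (norm u)\<^sup>2"
      unfolding eq s_def[symmetric] by linarith
  qed
qed

text \<open>Off \<open>K\<close> the cones are uniformly semiconcave near \<open>x\<close>: those with apex near \<open>x\<close> are smoothed on
  the scale \<open>apex_width K z\<close>, and the others have their apex far away.\<close>

lemma has_supergradient_cone_envelope_off:
  assumes "x \<notin> K"
  shows "\<exists>\<xi>. has_supergradient (cone_envelope m M K) \<xi> x"
proof -
  define r where "r = infdist x K / 2"
  \<comment> \<open>An apex within \<open>r\<close> of \<open>x\<close> is still at distance at
    least \<open>r\<close> from \<open>K\<close>, so its width is at least \<open>r\<^sup>2\<close>;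
    any other apex is at distance at least \<open>r\<close> from \<open>x\<close>.\<close>
  define s0 where "s0 = min r (r\<^sup>2)"
  let ?h = "cone_envelope m M K"
  have r: "0 < r"
    using assms K in_closed_iff_infdist_zero[of K x] infdist_nonneg[of x K] by (simp add: r_def)
  then have s0: "0 < s0"
    by (simp add: s0_def)
  have s0_le: "s0 \<le> sqrt ((norm (x - z))\<^sup>2 + (apex_width K z)\<^sup>2)" for z
  proof (cases "norm (x - z) < r")
    case True
    have "infdist x K \<le> infdist z K + norm (x - z)"
      using infdist_triangle[of x K z] by (simp add: dist_norm)
    then have "r \<le> infdist z K"
      using True by (simp add: r_def)
    then have "r\<^sup>2 \<le> apex_width K z"
      using r unfolding apex_width_def by (intro power_mono) auto
    then have "(r\<^sup>2)\<^sup>2 \<le> (apex_width K z)\<^sup>2"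
      by (rule power_mono) simp
    then have "r\<^sup>2 \<le> sqrt ((norm (x - z))\<^sup>2 + (apex_width K z)\<^sup>2)"
      by (intro real_le_rsqrt) (simp add: add_increasing)
    then show ?thesis
      by (simp add: s0_def)
  next
    case False
    then have "r\<^sup>2 \<le> (norm (x - z))\<^sup>2"
      using r by (intro power_mono) auto
    then have "r \<le> sqrt ((norm (x - z))\<^sup>2 + (apex_width K z)\<^sup>2)"
      by (intro real_le_rsqrt) (simp add: add_increasing2)
    then show ?thesis
      by (simp add: s0_def)
  qed
  \<comment> \<open>Cones nearly attaining the infimum at \<open>x\<close> have slopes in the ball
    of radius \<open>M\<close>; a limit of these slopes will be the supergradient.\<close>
  have "\<exists>\<xi> e. norm \<xi> \<le> M \<and> e < 1 / Suc n
      \<and> (\<forall>u. ?h (x + u) \<le> ?h x + e + \<xi> \<bullet> u + M / (2 * s0) * (norm u)\<^sup>2)" for n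
  proof -
    have "\<not> (\<forall>z. ?h x + 1 / Suc n \<le> smoothed_cone z x)"
      using cone_envelope_greatest[of "?h x + 1 / Suc n" x] by auto
    then obtain z where "smoothed_cone z x < ?h x + 1 / Suc n"
      by (meson not_le)
    then have z: "smoothed_cone z x - ?h x < 1 / Suc n"
      by linarith
    obtain \<xi> where \<xi>: "norm \<xi> \<le> M"
      "\<And>u. smoothed_cone z (x + u) \<le> smoothed_cone z x + \<xi> \<bullet> u + M / (2 * s0) * (norm u)\<^sup>2"
      using cone_shift_le[OF s0 s0_le[of z]] by blast
    show ?thesis
    proof (intro exI conjI allI)
      show "norm \<xi> \<le> M" "smoothed_cone z x - ?h x < 1 / Suc n"
        by fact+
      show "?h (x + u) \<le> ?h x + (smoothed_cone z x - ?h x) + \<xi> \<bullet> u + M / (2 * s0) * (norm u)\<^sup>2" for u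
        using \<xi>(2)[of u] cone_envelope_le_cone[of "x + u" z] by linarith
    qed
  qed
  then obtain \<xi> e where \<xi>: "\<And>n. norm (\<xi> n) \<le> M" and e: "\<And>n. e n < 1 / Suc n"
    and h: "\<And>n u. ?h (x + u) \<le> ?h x + e n + \<xi> n \<bullet> u + M / (2 * s0) * (norm u)\<^sup>2"
    by metis
  have "\<forall>n. \<xi> n \<in> cball 0 M"
    using \<xi> by simp
  then obtain l \<sigma> where \<sigma>: "strict_mono \<sigma>" "(\<xi> \<circ> \<sigma>) \<longlonglongrightarrow> l"
    using seq_compactE[OF compact_imp_seq_compact[OF compact_cball]] by metis
  have "?h (x + u) \<le> ?h x + l \<bullet> u + M / (2 * s0) * (norm u)\<^sup>2" for u
  proof (rule LIMSEQ_le_const)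
    have "(\<lambda>n. 1 / real (Suc (\<sigma> n))) \<longlonglongrightarrow> 0"
      using LIMSEQ_subseq_LIMSEQ[OF LIMSEQ_inverse_real_of_nat \<sigma>(1)]
      by (simp add: o_def inverse_eq_divide)
    then have "(\<lambda>n. ?h x + 1 / Suc (\<sigma> n) + \<xi> (\<sigma> n) \<bullet> u + M / (2 * s0) * (norm u)\<^sup>2)
        \<longlonglongrightarrow> ?h x + 0 + l \<bullet> u + M / (2 * s0) * (norm u)\<^sup>2"
      using \<sigma>(2) by (intro tendsto_intros) (simp_all add: o_def)
    then show "(\<lambda>n. ?h x + 1 / Suc (\<sigma> n) + \<xi> (\<sigma> n) \<bullet> u + M / (2 * s0) * (norm u)\<^sup>2)
        \<longlonglongrightarrow> ?h x + l \<bullet> u + M / (2 * s0) * (norm u)\<^sup>2"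
      by simp
    have "?h (x + u) \<le> ?h x + 1 / Suc (\<sigma> n) + \<xi> (\<sigma> n) \<bullet> u + M / (2 * s0) * (norm u)\<^sup>2" for n
      using h[of u "\<sigma> n"] e[of "\<sigma> n"] by linarith
    then show "\<exists>k. \<forall>n\<ge>k. ?h (x + u)
        \<le> ?h x + 1 / Suc (\<sigma> n) + \<xi> (\<sigma> n) \<bullet> u + M / (2 * s0) * (norm u)\<^sup>2"
      by blast
  qed
  then have "has_supergradient ?h l x"
    using M s0 by (intro has_supergradient_quadratic[of "M / (2 * s0)"]) auto
  then show ?thesis
    by blast
qed

text \<open>At a point of \<open>K\<close> the distance from \<open>x + u\<close> to
  \<open>K\<close> is at most \<open>norm u\<close>, so the excess over \<open>m\<close> is at most
  \<open>M * (norm u)\<^sup>2\<close>.\<close>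

lemma has_supergradient_cone_envelope:
  assumes "\<And>x. x \<in> K \<Longrightarrow> \<exists>\<xi>. has_supergradient m \<xi> x"
  shows "\<exists>\<xi>. has_supergradient (cone_envelope m M K) \<xi> x"
proof (cases "x \<in> K")
  case True
  then obtain \<xi> where \<xi>: "has_supergradient m \<xi> x"
    using assms by blast
  have "has_supergradient (cone_envelope m M K) \<xi> x"
  proof (rule has_supergradient_majorant[where h = "cone_envelope m M K", OF \<xi> cone_envelope_eq[OF True] M])
    fix u
    have "(infdist (x + u) K)\<^sup>2 \<le> (norm u)\<^sup>2"
      using infdist_le[OF True, of "x + u"] by (intro power_mono) (auto simp: dist_norm infdist_nonneg)
    then have "M * (infdist (x + u) K)\<^sup>2 \<le> M * (norm u)\<^sup>2"
      using M by (rule mult_left_mono)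
    then show "cone_envelope m M K (x + u) \<le> m (x + u) + M * (norm u)\<^sup>2"
      using cone_envelope_le[of "x + u"] by linarith
  qed
  then show ?thesis
    by blast
qed (rule has_supergradient_cone_envelope_off)

end

lemma convex_C1_majorant:
  fixes m :: "'a::euclidean_space \<Rightarrow> real"
  assumes m: "lipschitz_with_contact_set m M K" "convex_on UNIV m"
    and X: "subspace X"
    and shift: "\<And>x w. w \<in> X\<^sup>\<bottom> \<Longrightarrow> m (x + w) = m x + v \<bullet> w"
    and K_shift: "\<And>w. w \<in> X\<^sup>\<bottom> \<Longrightarrow> (+) w ` K = K"
    and "0 < r" and low: "\<And>x. r * norm (orth_proj X x) - C \<le> m x - v \<bullet> x"
    and sg: "\<And>x. x \<in> K \<Longrightarrow> \<exists>\<xi>. has_supergradient m \<xi> x"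
  obtains F DF where "convex_on UNIV F" "\<And>x y. F y \<le> F x + M * norm (y - x)"
    "\<And>x. has_supergradient F (DF x) x" "\<And>x. m x \<le> F x" "\<And>x. x \<in> K \<Longrightarrow> F x = m x"
    "coercive_directions F = X"
proof -
  interpret lipschitz_with_contact_set m M K
    by fact
  define h where "h = cone_envelope m M K"
  interpret convex_minorant h m
    using m(2) by unfold_locales (auto simp: h_def cone_envelope_ge)
  define F where "F = convex_envelope h"
  have h_lip: "h (x + u) \<le> h x + M * norm u" for x u
    unfolding h_def by (rule cone_envelope_lipschitz)
  have h_shift: "h (x + w) = h x + v \<bullet> w" if "w \<in> X\<^sup>\<bottom>" for x w
    unfolding h_def by (rule cone_envelope_shift[OF shift[OF that] K_shift[OF that]])
  have "h y \<le> h x + M * norm (y - x)" for x y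
    using h_lip[of x "y - x"] by simp
  then have "M-lipschitz_on UNIV h"
    by (rule lipschitz_on_UNIV_I[OF M])
  then have h_cont: "continuous_on UNIV h"
    by (rule lipschitz_on_continuous_on)
  have "r * norm (orth_proj X x) - C \<le> h x - v \<bullet> x" for x
    using low[of x] m_le[of x] by linarith
  then have "\<exists>\<xi>. has_supergradient F \<xi> x" for x
    unfolding F_def
    by (intro has_supergradient_convex_envelope[where X = X and v = v and r = r and C = C and m = m])
      (use convex_minorant_axioms h_cont X h_shift \<open>0 < r\<close> has_supergradient_cone_envelope[OF sg]
        in \<open>auto simp: h_def\<close>)
  then obtain DF where DF: "\<And>x. has_supergradient F (DF x) x"
    by metis
  have F_convex: "convex_on UNIV F"
    unfolding F_def by (rule convex_convex_envelope)
  have F_ge: "m x \<le> F x" for x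
    unfolding F_def by (rule convex_envelope_ge)
  have F_eq: "F x = m x" if "x \<in> K" for x
    using F_ge[of x] convex_envelope_le[of x] cone_envelope_eq[OF that] by (simp add: F_def h_def)
  have F_lip: "F y \<le> F x + M * norm (y - x)" for x y
    using convex_envelope_shift_le[OF h_lip, of x "y - x"] by (simp add: F_def)
  have F_shift: "F (x + w) \<le> F x + v \<bullet> w" if "w \<in> X\<^sup>\<bottom>" for x w
    unfolding F_def using h_shift[OF that] by (intro convex_envelope_shift_le) simp
  have "coercivity_space F X"
    unfolding coercivity_space_def
  proof (intro conjI exI allI)
    show "subspace X"
      by fact
    have "convex_on UNIV (\<lambda>x. F x + (- v) \<bullet> x)"
      by (intro convex_on_add F_convex)
        (auto intro!: convex_onI simp: inner_add_right)
    then show "convex_on X (\<lambda>x. F x - v \<bullet> x)"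
      using subspace_imp_convex[OF X] by (auto intro: convex_on_subset)
    show "F x = F (orth_proj X x) - v \<bullet> orth_proj X x + v \<bullet> x" for x
    proof -
      define w where "w = x - orth_proj X x"
      have w: "w \<in> X\<^sup>\<bottom>"
        by (simp add: w_def orth_proj_props X)
      \<comment> \<open>\<open>F_shift\<close> is only an upper bound; used for both
        \<open>w\<close> and \<open>- w\<close> it becomes the equality.\<close>
      then have "- w \<in> X\<^sup>\<bottom>"
        by (simp add: subspace_neg subspace_orthogonal_comp)
      from F_shift[OF this, of x] F_shift[OF w, of "orth_proj X x"] show ?thesis
        by (simp add: w_def inner_diff_right)
    qed
    show "coercive_on X (\<lambda>x. F x - v \<bullet> x)"
      unfolding coercive_on_def filterlim_at_top
    proof
      fix Z
      have "Z \<le> F x - v \<bullet> x" if "x \<in> X" "(\<bar>Z\<bar> + \<bar>C\<bar>) / r \<le> norm x" for x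
      proof -
        have "orth_proj X x = x"
          using X that(1) by (intro orth_proj_eqI) (auto simp: subspace_0 subspace_orthogonal_comp)
        moreover have "\<bar>Z\<bar> + \<bar>C\<bar> \<le> r * norm x"
          using that(2) \<open>0 < r\<close> by (simp add: field_simps)
        ultimately show ?thesis
          using low[of x] F_ge[of x] by simp
      qed
      then show "eventually (\<lambda>x. Z \<le> F x - v \<bullet> x) (inf at_infinity (principal X))"
        by (auto simp: eventually_inf_principal eventually_at_infinity)
    qed
  qed
  then show ?thesis
    using that F_convex F_lip DF F_ge F_eq coercive_directions_eq by blast
qed

section \<open>Suprema of affine functions\<close>

lemma average_diff_in_span:
  assumes "finite A" "g \<in> A"
  shows "g - (\<Sum>A) /\<^sub>R card A \<in> span {g - g' | g g'. g \<in> A \<and> g' \<in> A}"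
proof -
  have "card A > 0"
    using assms card_gt_0_iff by blast
  have "(\<Sum>g'\<in>A. g - g') /\<^sub>R card A \<in> span {g - g' | g g'. g \<in> A \<and> g' \<in> A}"
    using assms(2) by (intro span_scale span_sum span_base) auto
  also have "(\<Sum>g'\<in>A. g - g') /\<^sub>R card A = g - (\<Sum>A) /\<^sub>R card A"
    using \<open>card A > 0\<close> by (simp add: sum_subtractf sum_constant_scaleR scaleR_diff_right)
  finally show ?thesis .
qed

text \<open>Strict convexity of the Euclidean ball, through the variance identity: the sum of
  squared deviations from the average is positive and equals the sum of squared norms minus
  \<open>N * (v \<bullet> v)\<close>.\<close>

lemma norm_average_less:
  fixes A :: "'a::euclidean_space set"
  assumes "finite A" and le: "\<And>g. g \<in> A \<Longrightarrow> norm g \<le> M" and "g1 \<in> A" "g2 \<in> A" "g1 \<noteq> g2"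
  shows "norm ((\<Sum>A) /\<^sub>R card A) < M"
proof -
  define N where "N = real (card A)"
  define v where "v = (\<Sum>A) /\<^sub>R N"
  have N: "N > 0"
    using assms card_gt_0_iff by (auto simp: N_def)
  then have sumA: "\<Sum>A = N *\<^sub>R v"
    by (simp add: v_def)
  have "\<exists>g\<in>A. g \<noteq> v"
    using assms(3-5) by (cases "g1 = v") auto
  then have "0 < (\<Sum>g\<in>A. (g - v) \<bullet> (g - v))"
    using \<open>finite A\<close> by (auto intro!: sum_pos2)
  also have "\<dots> = (\<Sum>g\<in>A. g \<bullet> g) - 2 * (\<Sum>A \<bullet> v) + N * (v \<bullet> v)"
    by (simp add: inner_diff_left inner_diff_right sum.distrib sum_subtractf inner_sum_left
        inner_sum_right inner_commute N_def algebra_simps flip: sum_distrib_right)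
  also have "\<dots> = (\<Sum>g\<in>A. g \<bullet> g) - N * (v \<bullet> v)"
    by (simp add: sumA)
  also have "(\<Sum>g\<in>A. g \<bullet> g) \<le> (\<Sum>g\<in>A. M\<^sup>2)"
    using le by (intro sum_mono) (auto simp: dot_square_norm intro!: power_mono)
  also have "\<dots> = N * M\<^sup>2"
    by (simp add: N_def)
  finally have "N * (v \<bullet> v) < N * M\<^sup>2"
    by simp
  then have "(norm v)\<^sup>2 < M\<^sup>2"
    using N by (simp add: dot_square_norm)
  moreover have "0 \<le> M"
    using le[OF \<open>g1 \<in> A\<close>] norm_ge_zero[of g1] by linarith
  ultimately show ?thesis
    unfolding v_def N_def by (rule power_less_imp_less_base)
qed

text \<open>In terms of support functions, the average lies in the relative interior of the convex
  hull of \<open>A\<close>. The numbers \<open>(g - v) \<bullet> x\<close> sum to zero, so they have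
  a positive part unless all vanish, which makes \<open>x\<close> orthogonal to \<open>Z\<close>.
  Compactness of the unit sphere of \<open>Z\<close> makes this quantitative.\<close>

lemma average_interior:
  fixes A :: "'a::euclidean_space set"
  assumes "finite A" "A \<noteq> {}"
  defines "Z \<equiv> span {g - g' | g g'. g \<in> A \<and> g' \<in> A}"
    and "v \<equiv> (\<Sum>A) /\<^sub>R card A"
  obtains r where "0 < r" "\<And>x. \<exists>g\<in>A. r * norm (orth_proj Z x) \<le> (g - v) \<bullet> x"
proof -
  define N where "N = real (card A)"
  have N: "N > 0"
    using assms(1,2) by (simp add: N_def card_gt_0_iff)
  have Z: "subspace Z"
    by (simp add: Z_def)
  have vZ: "g - v \<in> Z" if "g \<in> A" for g
    unfolding Z_def v_def by (rule average_diff_in_span[OF \<open>finite A\<close> that])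
  have sum0: "(\<Sum>g\<in>A. (g - v) \<bullet> x) = 0" for x
  proof -
    have "(\<Sum>g\<in>A. g - v) = 0"
      using N by (simp add: sum_subtractf sum_constant_scaleR v_def N_def)
    then show ?thesis
      by (metis inner_sum_left inner_zero_left)
  qed
  define S where "S x = (\<Sum>g\<in>A. max 0 ((g - v) \<bullet> x))" for x
  have S_pos: "0 < S x" if "x \<in> Z" "x \<noteq> 0" for x
  proof (rule ccontr)
    assume neg: "\<not> 0 < S x"
    have "0 \<le> S x"
      unfolding S_def by (intro sum_nonneg) simp
    with neg have "S x = 0"
      by simp
    then have "\<forall>g\<in>A. max 0 ((g - v) \<bullet> x) = 0"
      using \<open>finite A\<close> sum_nonneg_eq_0_iff[of A "\<lambda>g. max 0 ((g - v) \<bullet> x)"]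
      by (simp add: S_def)
    then have le0: "0 \<le> - ((g - v) \<bullet> x)" if "g \<in> A" for g
      using that by (metis max.cobounded2 neg_0_le_iff_le)
    define \<phi> where "\<phi> g = - ((g - v) \<bullet> x)" for g
    have "sum \<phi> A = - (\<Sum>g\<in>A. (g - v) \<bullet> x)"
      unfolding \<phi>_def by (rule sum_negf)
    then have "sum \<phi> A = 0"
      unfolding sum0 by simp
    moreover have "\<forall>g\<in>A. 0 \<le> \<phi> g"
      using le0 unfolding \<phi>_def by blast
    ultimately have "\<phi> g = 0" if "g \<in> A" for g
      using that \<open>finite A\<close> sum_nonneg_eq_0_iff[of A \<phi>] by blast
    then have eq: "g \<bullet> x = v \<bullet> x" if "g \<in> A" for g
      using that by (simp add: \<phi>_def inner_diff_left)
    have "orthogonal x d" if d: "d \<in> {g - g' | g g'. g \<in> A \<and> g' \<in> A}" for d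
    proof -
      obtain g g' where "g \<in> A" "g' \<in> A" "d = g - g'"
        using d by blast
      then show ?thesis
        using eq[of g] eq[of g'] by (simp add: orthogonal_def inner_diff_right inner_commute)
    qed
    then have "orthogonal x x"
      using orthogonal_to_span \<open>x \<in> Z\<close> unfolding Z_def by blast
    with \<open>x \<noteq> 0\<close> show False
      by (simp add: orthogonal_def)
  qed
  \<comment> \<open>The sphere is empty for \<open>Z = {0}\<close>, where any positive constant will
    do.\<close>
  obtain \<rho> where \<rho>: "0 < \<rho>" "\<And>x. x \<in> Z \<Longrightarrow> norm x = 1 \<Longrightarrow> \<rho> \<le> S x"
  proof (cases "Z \<inter> sphere 0 1 = {}")
    case True
    then have "1 \<le> S x" if "x \<in> Z" "norm x = 1" for x
      using that by auto
    then show ?thesis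
      by (intro that[of 1]) auto
  next
    case False
    have "continuous_on (Z \<inter> sphere 0 1) S"
      unfolding S_def by (intro continuous_intros)
    moreover have "compact (Z \<inter> sphere 0 1)"
      using closed_subspace[OF Z] by (simp add: closed_Int_compact)
    ultimately obtain x where x: "x \<in> Z \<inter> sphere 0 1" "\<And>y. y \<in> Z \<inter> sphere 0 1 \<Longrightarrow> S x \<le> S y"
      using continuous_attains_inf[OF _ False] by blast
    have "0 < S x"
      using x(1) by (intro S_pos) auto
    then show ?thesis
      using that[of "S x"] x by auto
  qed
  show ?thesis
  proof (rule that)
    show "0 < \<rho> / N"
      using \<rho> N by simp
    fix x
    define p where "p = orth_proj Z x"
    have p: "p \<in> Z"
      by (simp add: p_def orth_proj_props Z)
    have px: "(g - v) \<bullet> p = (g - v) \<bullet> x" if "g \<in> A" for g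
      unfolding p_def by (rule inner_orth_proj[OF Z vZ[OF that]])
    show "\<exists>g\<in>A. \<rho> / N * norm (orth_proj Z x) \<le> (g - v) \<bullet> x"
    proof (rule ccontr)
      assume "\<not> ?thesis"
      then have lt: "(g - v) \<bullet> p < \<rho> / N * norm p" if "g \<in> A" for g
        using px[OF that] that by (auto simp: p_def not_le)
      show False
      proof (cases "p = 0")
        case True
        then show ?thesis
          using lt \<open>A \<noteq> {}\<close> by auto
      next
        case False
        define q where "q = p /\<^sub>R norm p"
        have "q \<in> Z" "norm q = 1"
          using p False Z by (auto simp: q_def subspace_scale)
        then have "\<rho> \<le> S q"
          by (rule \<rho>)
        also have "S q < (\<Sum>g\<in>A. \<rho> / N)"
          unfolding S_def
        proof (intro sum_strict_mono \<open>finite A\<close> \<open>A \<noteq> {}\<close>)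
          fix g assume "g \<in> A"
          then show "max 0 ((g - v) \<bullet> q) < \<rho> / N"
            using lt[of g] False \<rho>(1) N by (simp add: q_def field_simps)
        qed
        also have "\<dots> = \<rho>"
          using N by (simp add: N_def)
        finally show False
          by simp
      qed
    qed
  qed
qed

text \<open>A pair encodes an affine function by its gradient and its constant term. A bound at the
  single point \<open>x1\<close>, with the common gradient bound, makes the supremum finite
  everywhere.\<close>

locale affine_family =
  fixes \<Psi> :: "('a::euclidean_space \<times> real) set" and M :: real and x1 :: 'a and b :: real
  assumes nonempty: "\<Psi> \<noteq> {}"
    and norm_le: "\<And>\<psi>. \<psi> \<in> \<Psi> \<Longrightarrow> norm (fst \<psi>) \<le> M"
    and bounded_at: "\<And>\<psi>. \<psi> \<in> \<Psi> \<Longrightarrow> fst \<psi> \<bullet> x1 + snd \<psi> \<le> b"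
begin

definition envelope :: "'a \<Rightarrow> real"
  where "envelope x = (SUP \<psi>\<in>\<Psi>. fst \<psi> \<bullet> x + snd \<psi>)"

lemma M_nonneg: "0 \<le> M"
  using nonempty norm_le norm_ge_zero order_trans by blast

lemma inner_le_norm:
  assumes "\<psi> \<in> \<Psi>"
  shows "\<bar>fst \<psi> \<bullet> u\<bar> \<le> M * norm u"
  using Cauchy_Schwarz_ineq2[of "fst \<psi>" u]
    mult_right_mono[OF norm_le[OF assms] norm_ge_zero[of u]]
  by linarith

lemma bdd_above_affine: "bdd_above ((\<lambda>\<psi>. fst \<psi> \<bullet> x + snd \<psi>) ` \<Psi>)"
proof (rule bdd_aboveI2)
  fix \<psi> assume \<psi>: "\<psi> \<in> \<Psi>"
  show "fst \<psi> \<bullet> x + snd \<psi> \<le> b + M * norm (x - x1)"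
    using bounded_at[OF \<psi>] inner_le_norm[OF \<psi>, of "x - x1"] by (simp add: inner_diff_right)
qed

lemma envelope_ge: "\<psi> \<in> \<Psi> \<Longrightarrow> fst \<psi> \<bullet> x + snd \<psi> \<le> envelope x"
  unfolding envelope_def by (rule cSUP_upper[OF _ bdd_above_affine])

lemma envelope_le: "(\<And>\<psi>. \<psi> \<in> \<Psi> \<Longrightarrow> fst \<psi> \<bullet> x + snd \<psi> \<le> c) \<Longrightarrow> envelope x \<le> c"
  unfolding envelope_def by (rule cSUP_least[OF nonempty])

lemma less_envelope: "c < envelope x \<longleftrightarrow> (\<exists>\<psi>\<in>\<Psi>. c < fst \<psi> \<bullet> x + snd \<psi>)"
  unfolding envelope_def by (rule less_cSUP_iff[OF nonempty bdd_above_affine])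

lemma convex_on_envelope: "convex_on UNIV envelope"
proof (rule convex_onI)
  fix t :: real and x y :: 'a
  assume t: "0 < t" "t < 1"
  show "envelope ((1 - t) *\<^sub>R x + t *\<^sub>R y) \<le> (1 - t) * envelope x + t * envelope y"
  proof (rule envelope_le)
    fix \<psi> assume \<psi>: "\<psi> \<in> \<Psi>"
    have "fst \<psi> \<bullet> ((1 - t) *\<^sub>R x + t *\<^sub>R y) + snd \<psi>
        = (1 - t) * (fst \<psi> \<bullet> x + snd \<psi>) + t * (fst \<psi> \<bullet> y + snd \<psi>)"
      by (simp add: algebra_simps)
    also have "\<dots> \<le> (1 - t) * envelope x + t * envelope y"
      using t envelope_ge[OF \<psi>] by (intro add_mono mult_left_mono) auto
    finally show "fst \<psi> \<bullet> ((1 - t) *\<^sub>R x + t *\<^sub>R y) + snd \<psi>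
      \<le> (1 - t) * envelope x + t * envelope y" .
  qed
qed simp

lemma lipschitz_envelope: "envelope y \<le> envelope x + M * norm (y - x)"
proof (rule envelope_le)
  fix \<psi> assume \<psi>: "\<psi> \<in> \<Psi>"
  show "fst \<psi> \<bullet> y + snd \<psi> \<le> envelope x + M * norm (y - x)"
    using inner_le_norm[OF \<psi>, of "y - x"] envelope_ge[OF \<psi>, of x] by (simp add: inner_diff_right)
qed

lemma continuous_on_envelope: "continuous_on UNIV envelope"
  using lipschitz_on_UNIV_I[OF M_nonneg lipschitz_envelope] by (rule lipschitz_on_continuous_on)

lemma envelope_shift:
  assumes "\<And>\<psi>. \<psi> \<in> \<Psi> \<Longrightarrow> fst \<psi> \<bullet> w = c"
  shows "envelope (x + w) = envelope x + c"
proof (rule antisym)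
  show "envelope (x + w) \<le> envelope x + c"
    using envelope_ge[of _ x] by (intro envelope_le) (simp add: inner_add_right assms)
  have "envelope x \<le> envelope (x + w) - c"
    using envelope_ge[of _ "x + w"]
    by (intro envelope_le) (simp add: inner_add_right assms algebra_simps)
  then show "envelope x + c \<le> envelope (x + w)"
    by simp
qed

text \<open>One affine function is selected for each gradient in \<open>A\<close>. By
  \<open>average_interior\<close> one of them grows fast enough, and the finitely many constant
  terms cost at most the sum of their absolute values.\<close>

lemma envelope_coercive:
  assumes A: "finite A" "A \<noteq> {}" "A \<subseteq> fst ` \<Psi>"
  defines "Z \<equiv> span {g - g' | g g'. g \<in> A \<and> g' \<in> A}"
    and "v \<equiv> (\<Sum>A) /\<^sub>R card A"
  obtains r C where "0 < r" "\<And>x. r * norm (orth_proj Z x) - C \<le> envelope x - v \<bullet> x"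
proof -
  obtain r where r: "0 < r" "\<And>x. \<exists>g\<in>A. r * norm (orth_proj Z x) \<le> (g - v) \<bullet> x"
    using average_interior[OF A(1,2)] unfolding Z_def v_def by blast
  have "\<forall>g\<in>A. \<exists>t. (g, t) \<in> \<Psi>"
    using A(3) by force
  then obtain c where c: "\<And>g. g \<in> A \<Longrightarrow> (g, c g) \<in> \<Psi>"
    by metis
  show ?thesis
  proof (rule that[OF r(1)])
    fix x
    obtain g where g: "g \<in> A" "r * norm (orth_proj Z x) \<le> (g - v) \<bullet> x"
      using r(2) by blast
    have "\<bar>c g\<bar> \<le> (\<Sum>g\<in>A. \<bar>c g\<bar>)"
      using g(1) A(1) by (intro member_le_sum) auto
    then show "r * norm (orth_proj Z x) - (\<Sum>g\<in>A. \<bar>c g\<bar>) \<le> envelope x - v \<bullet> x"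
      using g(2) envelope_ge[OF c[OF g(1)], of x] by (simp add: inner_diff_left)
  qed
qed

end

section \<open>Envelopes of 1-jets\<close>

lemma closure_translate_eq:
  fixes S :: "'a::real_normed_vector set"
  assumes "\<And>x. x \<in> S \<Longrightarrow> x + w \<in> S" "\<And>x. x \<in> S \<Longrightarrow> x - w \<in> S"
  shows "(+) w ` closure S = closure S"
proof -
  have "(+) w ` S = S"
  proof
    show "(+) w ` S \<subseteq> S"
      using assms(1) by (auto simp: add.commute)
    show "S \<subseteq> (+) w ` S"
    proof
      fix x assume "x \<in> S"
      then show "x \<in> (+) w ` S"
        using assms(2)[of x] by (intro image_eqI[of _ _ "x - w"]) auto
    qed
  qed
  then show ?thesis
    by (metis closure_translation)
qed

context affine_family
begin

text \<open>Differentiability of the envelope along \<open>E + X\<^sup>\<bottom>\<close>: if \<open>g\<close> is a limit of gradients at nearby data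
  points and the inequality fails along \<open>u \<rightarrow> 0\<close>, then the affine functions nearly attaining the
  envelope at \<open>y + u\<close> stay away from \<open>g\<close> in slope while nearly attaining it at \<open>y\<close>,
  which the last hypothesis forbids.\<close>

lemma has_supergradient_envelope:
  fixes f :: "'a \<Rightarrow> real" and G :: "'a \<Rightarrow> 'a"
  assumes X: "subspace X"
    and shift: "\<And>\<psi> w. \<psi> \<in> \<Psi> \<Longrightarrow> w \<in> X\<^sup>\<bottom> \<Longrightarrow> fst \<psi> \<bullet> w = v \<bullet> w"
    and jet: "\<And>z. z \<in> E \<Longrightarrow> (G z, f z - G z \<bullet> z) \<in> \<Psi>"
    and other: "\<And>\<psi> x. \<psi> \<in> \<Psi> \<Longrightarrow> \<psi> \<notin> (\<lambda>z. (G z, f z - G z \<bullet> z)) ` E \<Longrightarrow> x \<in> E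
      \<Longrightarrow> fst \<psi> \<bullet> x + snd \<psi> \<le> f x - 1"
    and eq: "\<And>x. x \<in> E \<Longrightarrow> envelope x = f x"
    and sep: "\<And>x z :: nat \<Rightarrow> 'a.
      (\<And>j. x j \<in> E) \<Longrightarrow> (\<And>j. z j \<in> E) \<Longrightarrow>
      bounded (range (\<lambda>j. orth_proj X (x j))) \<Longrightarrow>
      (\<lambda>j. f (x j) - f (z j) - G (z j) \<bullet> (x j - z j)) \<longlonglongrightarrow> 0 \<Longrightarrow>
      (\<lambda>j. norm (G (x j) - G (z j))) \<longlonglongrightarrow> 0"
    and y0: "y0 \<in> closure {x + w | x w. x \<in> E \<and> w \<in> X\<^sup>\<bottom>}"
  shows "\<exists>\<xi>. has_supergradient envelope \<xi> y0"
proof -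
  have env_shift: "envelope (x + w) = envelope x + v \<bullet> w" if "w \<in> X\<^sup>\<bottom>" for x w
    using shift[OF _ that] by (rule envelope_shift)
  obtain s where s: "\<And>n. s n \<in> {x + w | x w. x \<in> E \<and> w \<in> X\<^sup>\<bottom>}" "s \<longlonglongrightarrow> y0"
    using y0 unfolding closure_sequential by blast
  have "\<forall>n. \<exists>x w. x \<in> E \<and> w \<in> X\<^sup>\<bottom> \<and> s n = x + w"
    using s(1) by blast
  then obtain y' w' where y'w': "\<And>n. y' n \<in> E" "\<And>n. w' n \<in> X\<^sup>\<bottom>" "\<And>n. s n = y' n + w' n"
    by metis
  have "G (y' n) \<in> cball 0 M" for n
    using norm_le[OF jet[OF y'w'(1)]] by simp
  \<comment> \<open>The candidate supergradient is a cluster point of the gradients at the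
    approximating data points.\<close>
  then obtain g \<sigma> where \<sigma>: "strict_mono \<sigma>" "((\<lambda>n. G (y' n)) \<circ> \<sigma>) \<longlonglongrightarrow> g"
    using seq_compactE[OF compact_imp_seq_compact[OF compact_cball], of "\<lambda>n. G (y' n)" 0 M] by blast
  define y where "y n = y' (\<sigma> n)" for n
  define w where "w n = w' (\<sigma> n)" for n
  have yE: "y n \<in> E" and w: "w n \<in> X\<^sup>\<bottom>" for n
    by (simp_all add: y_def w_def y'w')
  have yw: "(\<lambda>n. y n + w n) \<longlonglongrightarrow> y0"
    using LIMSEQ_subseq_LIMSEQ[OF s(2) \<sigma>(1)] by (simp add: o_def y'w'(3) y_def w_def)
  have Gy: "(\<lambda>n. G (y n)) \<longlonglongrightarrow> g"
    using \<sigma>(2) by (simp add: o_def y_def)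
  have "norm g \<le> M"
    using norm_le[OF jet[OF yE]] by (intro LIMSEQ_le_const2[OF tendsto_norm[OF Gy]]) auto
  have yw_norm: "(\<lambda>n. norm (y n + w n - y0)) \<longlonglongrightarrow> 0"
    using yw by (simp add: LIM_zero tendsto_norm_zero)
  \<comment> \<open>The gap of 1 below \<open>f\<close> on \<open>E\<close> is unchanged by shifts
    orthogonal to \<open>X\<close>, and it passes to the limit \<open>y0\<close> by continuity of
    the envelope.\<close>
  have other': "fst \<psi> \<bullet> y0 + snd \<psi> \<le> envelope y0 - 1"
    if \<psi>: "\<psi> \<in> \<Psi>" "\<psi> \<notin> (\<lambda>z. (G z, f z - G z \<bullet> z)) ` E" for \<psi>
  proof (rule LIMSEQ_le)
    have "(\<lambda>n. envelope (y n + w n) - 1) \<longlonglongrightarrow> envelope y0 - 1"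
      using continuous_on_tendsto_compose[OF continuous_on_envelope yw]
      by (intro tendsto_diff tendsto_const) simp
    then show "(\<lambda>n. envelope (y n + w n) - 1) \<longlonglongrightarrow> envelope y0 - 1" .
    show "(\<lambda>n. fst \<psi> \<bullet> (y n + w n) + snd \<psi>) \<longlonglongrightarrow> fst \<psi> \<bullet> y0 + snd \<psi>"
      by (intro tendsto_intros yw)
    have "fst \<psi> \<bullet> (y n + w n) + snd \<psi> \<le> envelope (y n + w n) - 1" for n
      using other[OF \<psi> yE[of n]] eq[OF yE[of n]] shift[OF \<psi>(1) w[of n]] env_shift[OF w, of "y n" n]
      by (simp add: inner_add_right)
    then show "\<exists>N. \<forall>n\<ge>N. fst \<psi> \<bullet> (y n + w n) + snd \<psi> \<le> envelope (y n + w n) - 1"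
      by blast
  qed
  have "has_supergradient envelope g y0"
  proof (rule ccontr)
    assume "\<not> has_supergradient envelope g y0"
    then obtain e where e: "e > 0"
      "\<And>d. d > 0 \<Longrightarrow> \<exists>u. norm u < d \<and> envelope y0 + g \<bullet> u + e * norm u < envelope (y0 + u)"
      unfolding has_supergradient_def by (auto simp: not_le)
    \<comment> \<open>Passing from \<open>y0 + u\<close> back to \<open>y0\<close> costs at most
      \<open>2 * M * norm u\<close>, as both slopes have norm at most \<open>M\<close>; the extra 1
      keeps the divisor positive if \<open>M = 0\<close>.\<close>
    have "\<exists>u \<psi>. \<psi> \<in> \<Psi> \<and> (2 * M + 1) * norm u < 1 / Suc n
        \<and> envelope y0 + g \<bullet> u + e * norm u < fst \<psi> \<bullet> (y0 + u) + snd \<psi>" for n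
    proof -
      have "0 < 1 / Suc n / (2 * M + 1)"
        using M_nonneg by simp
      then obtain u where u: "norm u < 1 / Suc n / (2 * M + 1)"
        "envelope y0 + g \<bullet> u + e * norm u < envelope (y0 + u)"
        using e(2) by blast
      moreover have "(2 * M + 1) * norm u < 1 / Suc n"
        using u(1) M_nonneg pos_less_divide_eq[of "2 * M + 1" "norm u" "1 / Suc n"]
        by (simp only: mult.commute)
      ultimately show ?thesis
        unfolding less_envelope by blast
    qed
    then obtain u \<psi> where \<psi>: "\<And>n. \<psi> n \<in> \<Psi>" and u: "\<And>n. (2 * M + 1) * norm (u n) < 1 / Suc n"
      and gt: "\<And>n. envelope y0 + g \<bullet> u n + e * norm (u n) < fst (\<psi> n) \<bullet> (y0 + u n) + snd (\<psi> n)"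
      by metis
    have slope: "e \<le> norm (fst (\<psi> n) - g)" for n
    proof -
      have "e * norm (u n) < (fst (\<psi> n) - g) \<bullet> u n"
        using gt[of n] envelope_ge[OF \<psi>, of n y0] by (simp add: inner_diff_left inner_add_right)
      also have "\<dots> \<le> norm (fst (\<psi> n) - g) * norm (u n)"
        by (rule norm_cauchy_schwarz)
      finally show ?thesis
        by (meson linorder_not_le mult_right_mono norm_ge_zero order_less_imp_le)
    qed
    have near: "envelope y0 - 1 / Suc n < fst (\<psi> n) \<bullet> y0 + snd (\<psi> n)" for n
    proof -
      have "fst (\<psi> n) \<bullet> u n \<le> M * norm (u n)"
        using inner_le_norm[OF \<psi>, of n "u n"] by linarith
      moreover have "- (g \<bullet> u n) \<le> M * norm (u n)"
        using Cauchy_Schwarz_ineq2[of g "u n"] mult_right_mono[OF \<open>norm g \<le> M\<close> norm_ge_zero[of "u n"]]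
        by linarith
      moreover have "2 * (M * norm (u n)) \<le> (2 * M + 1) * norm (u n)"
        by (simp add: algebra_simps)
      moreover have "0 \<le> e * norm (u n)"
        using e(1) by simp
      ultimately show ?thesis
        using gt[of n] u[of n] unfolding inner_add_right by linarith
    qed
    have "\<exists>z\<in>E. \<psi> n = (G z, f z - G z \<bullet> z)" for n
    proof (rule ccontr)
      assume "\<not> ?thesis"
      then have "fst (\<psi> n) \<bullet> y0 + snd (\<psi> n) \<le> envelope y0 - 1"
        using other'[OF \<psi>] by blast
      moreover have "1 / Suc n \<le> (1::real)"
        by simp
      ultimately show False
        using near[of n] by linarith
    qed
    then obtain z where z: "\<And>n. z n \<in> E" "\<And>n. \<psi> n = (G (z n), f (z n) - G (z n) \<bullet> z n)"
      by metis
    \<comment> \<open>Shifting by \<open>w n\<close> changes \<open>f\<close> and the affine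
      function by the same amount, so the gap at \<open>y n\<close> can be computed at
      \<open>y n + w n\<close>, which is close to \<open>y0\<close>.\<close>
    have gap: "norm (f (y n) - f (z n) - G (z n) \<bullet> (y n - z n))
        \<le> 2 * M * norm (y n + w n - y0) + 1 / Suc n" for n
    proof -
      define \<delta> where "\<delta> = y n + w n - y0"
      have d: "y n + w n = y0 + \<delta>"
        by (simp add: \<delta>_def)
      have "f (y n) = envelope (y0 + \<delta>) - v \<bullet> w n"
        using env_shift[OF w, of "y n" n] eq[OF yE[of n]] by (simp add: d)
      moreover have "f (z n) + G (z n) \<bullet> (y n - z n) = fst (\<psi> n) \<bullet> (y0 + \<delta>) + snd (\<psi> n) - v \<bullet> w n"
        using shift[OF \<psi> w, of n n] by (simp add: z(2) inner_diff_right flip: d add: inner_add_right)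
      ultimately have "f (y n) - f (z n) - G (z n) \<bullet> (y n - z n)
          = envelope (y0 + \<delta>) - fst (\<psi> n) \<bullet> y0 - snd (\<psi> n) - fst (\<psi> n) \<bullet> \<delta>"
        by (simp add: inner_add_right)
      moreover have "envelope (y0 + \<delta>) \<le> envelope y0 + M * norm \<delta>"
        using lipschitz_envelope[of "y0 + \<delta>" y0] by simp
      moreover have "fst (\<psi> n) \<bullet> (y0 + \<delta>) + snd (\<psi> n) \<le> envelope (y0 + \<delta>)"
        by (rule envelope_ge[OF \<psi>])
      moreover have "\<bar>fst (\<psi> n) \<bullet> \<delta>\<bar> \<le> M * norm \<delta>"
        by (rule inner_le_norm[OF \<psi>])
      moreover have "0 \<le> M * norm \<delta>"
        using M_nonneg by simp
      moreover have "0 < 1 / real (Suc n)"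
        by simp
      ultimately show ?thesis
        using near[of n] unfolding \<delta>_def[symmetric] real_norm_def inner_add_right abs_le_iff mult.assoc
        by linarith
    qed
    have "(\<lambda>n. 2 * M * norm (y n + w n - y0) + 1 / Suc n) \<longlonglongrightarrow> 2 * M * 0 + 0"
      using LIMSEQ_inverse_real_of_nat
      by (intro tendsto_intros yw_norm) (simp add: inverse_eq_divide)
    then have lim0: "(\<lambda>n. 2 * M * norm (y n + w n - y0) + 1 / Suc n) \<longlonglongrightarrow> 0"
      by simp
    have gap0: "(\<lambda>n. f (y n) - f (z n) - G (z n) \<bullet> (y n - z n)) \<longlonglongrightarrow> 0"
      by (rule Lim_null_comparison[OF always_eventually lim0]) (use gap in blast)
    have "bounded (range (\<lambda>n. orth_proj X (y n)))"
    proof -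
      obtain B where B: "\<And>n. norm (y n + w n) \<le> B"
        using convergent_imp_bounded[OF yw] unfolding bounded_iff by blast
      have "norm (orth_proj X (y n)) \<le> B" for n
        using norm_orth_proj_le[OF X, of "y n + w n"] B[of n]
          orth_proj_add_orthogonal[OF X w, of "y n" n] by simp
      then show ?thesis
        unfolding bounded_iff by blast
    qed
    then have "(\<lambda>n. norm (G (y n) - G (z n))) \<longlonglongrightarrow> 0"
      by (rule sep[OF yE z(1) _ gap0])
    then have "(\<lambda>n. G (y n) - (G (y n) - G (z n))) \<longlonglongrightarrow> g - 0"
      by (intro tendsto_diff Gy) (simp add: tendsto_norm_zero_iff)
    then have "(\<lambda>n. G (z n) - g) \<longlonglongrightarrow> 0"
      by (simp add: LIM_zero_iff)
    then have "(\<lambda>n. norm (G (z n) - g)) \<longlonglongrightarrow> 0"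
      by (rule tendsto_norm_zero)
    then have "e \<le> 0"
      using slope by (intro LIMSEQ_le_const) (auto simp: z(2))
    with e(1) show False
      by simp
  qed
  then show ?thesis
    by blast
qed

end

text \<open>By dimension count \<open>W\<close> spans \<open>X \<inter> Y\<^sup>\<bottom>\<close>,
  and every vector of \<open>X\<close> is the sum of its projection to \<open>Y\<close> and a vector
  of that intersection.\<close>

lemma orthogonal_extension_spans:
  fixes W X Y :: "'a::euclidean_space set"
  assumes X: "subspace X" and Y: "subspace Y" "Y \<subseteq> X"
    and W: "finite W" "independent W" "W \<subseteq> X \<inter> Y\<^sup>\<bottom>" "card W = dim X - dim Y"
    and S: "subspace S" "Y \<subseteq> S" "W \<subseteq> S"
  shows "X \<subseteq> S"
proof -
  define V where "V = X \<inter> Y\<^sup>\<bottom>"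
  have V: "subspace V"
    unfolding V_def by (intro subspace_inter X subspace_orthogonal_comp)
  have "V = {y \<in> X. \<forall>x\<in>Y. orthogonal x y}"
    by (auto simp: V_def orthogonal_comp_def)
  then have "dim V + dim Y = dim X"
    using dim_subspace_orthogonal_to_vectors[OF Y(1) X Y(2)] by simp
  then have "card W = dim V"
    using W(4) by simp
  then have VW: "V \<subseteq> span W"
    using W(2,3) by (intro card_ge_dim_independent) (auto simp: V_def)
  show ?thesis
  proof
    fix x assume "x \<in> X"
    have "orth_proj Y x \<in> Y"
      by (rule orth_proj_props[OF Y(1)])
    moreover have "x - orth_proj Y x \<in> V"
      unfolding V_def using \<open>x \<in> X\<close> \<open>orth_proj Y x \<in> Y\<close> Y X orth_proj_props(2)[OF Y(1)]
      by (auto intro: subspace_diff)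
    then have "x - orth_proj Y x \<in> S"
      using VW span_minimal[OF S(3,1)] by blast
    ultimately show "x \<in> S"
      using S(1,2) subspace_add[of S "orth_proj Y x" "x - orth_proj Y x"] by auto
  qed
qed

theorem theorem1p1:
  fixes E X Y :: "(real ^ 'n) set"
    and f :: "real ^ 'n \<Rightarrow> real"
    and G :: "real ^ 'n \<Rightarrow> real ^ 'n"
  assumes X: "subspace X"
    and non_constant: "\<not> G constant_on E"
    and Y: "Y = span {G x - G y | x y. x \<in> E \<and> y \<in> E}"
    and i_cont: "continuous_on E G"
    and i_bounded: "bounded (G ` E)"
    and i_convex: "\<And>x y. x \<in> E \<Longrightarrow> y \<in> E \<Longrightarrow> f x \<ge> f y + G y \<bullet> (x - y)"
    and ii: "Y \<subseteq> X"
    and iii: "Y \<noteq> X \<Longrightarrow>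
      \<exists>(p :: nat \<Rightarrow> real ^ 'n) (\<epsilon> :: real) (w :: nat \<Rightarrow> real ^ 'n).
        (\<forall>j\<in>{1..dim X - dim Y}. p j \<notin> closure E) \<and>
        0 < \<epsilon> \<and> \<epsilon> < 1 \<and>
        (\<forall>j\<in>{1..dim X - dim Y}. norm (w j) = 1 \<and> w j \<in> X \<inter> Y\<^sup>\<bottom>) \<and>
        inj_on w {1..dim X - dim Y} \<and> independent (w ` {1..dim X - dim Y}) \<and>
        (\<forall>j\<in>{1..dim X - dim Y}. cone_at Y \<epsilon> (w j) (p j) \<inter> closure E = {})"
    and iv: "\<And>x z :: nat \<Rightarrow> real ^ 'n.
      (\<And>j. x j \<in> E) \<Longrightarrow> (\<And>j. z j \<in> E) \<Longrightarrow>
      bounded (range (\<lambda>j. orth_proj X (x j))) \<Longrightarrow>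
      (\<lambda>j. f (x j) - f (z j) - G (z j) \<bullet> (x j - z j)) \<longlonglongrightarrow> 0 \<Longrightarrow>
      (\<lambda>j. norm (G (x j) - G (z j))) \<longlonglongrightarrow> 0"
  shows "\<exists>(F :: real ^ 'n \<Rightarrow> real) (DF :: real ^ 'n \<Rightarrow> real ^ 'n).
      convex_on UNIV F \<and>
      (\<exists>L. L-lipschitz_on UNIV F) \<and>
      (\<forall>x. GDERIV F x :> DF x) \<and> continuous_on UNIV DF \<and>
      (\<forall>x\<in>E. F x = f x \<and> DF x = G x) \<and>
      coercive_directions F = X \<and>
      Lip F = (SUP x. norm (DF x)) \<and>
      (SUP x. norm (DF x)) = (SUP y\<in>E. norm (G y))"
proof -

  \<comment> \<open>The envelope of the data alone\<close>
  obtain x1 where x1: "x1 \<in> E"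
    using non_constant by (force simp: constant_on_def)
  define M where "M = (SUP y\<in>E. norm (G y))"
  have bdd: "bdd_above ((\<lambda>y. norm (G y)) ` E)"
    using bounded_imp_bdd_above[of "norm ` G ` E"] i_bounded
    by (simp add: image_image bounded_norm_comp)
  have GM: "norm (G y) \<le> M" if "y \<in> E" for y
    unfolding M_def using bdd that by (intro cSUP_upper)
  define jet where "jet z = (G z, f z - G z \<bullet> z)" for z
  have jet_le: "fst (jet z) \<bullet> x + snd (jet z) \<le> f x" if "x \<in> E" "z \<in> E" for x z
    using i_convex[OF that] by (simp add: jet_def inner_diff_right)
  \<comment> \<open>The data come first by themselves, since the coercivity constants
    \<open>r0\<close> and \<open>C0\<close> of their envelope along \<open>Y\<close> determine the
    functions to be added.\<close>
  interpret J: affine_family "jet ` E" M x1 "f x1"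
    using x1 GM jet_le[OF x1] by unfold_locales (auto simp: jet_def)
  have J_eq: "J.envelope x = f x" if "x \<in> E" for x
  proof (rule antisym)
    show "J.envelope x \<le> f x"
      using jet_le[OF that] by (intro J.envelope_le) auto
    show "f x \<le> J.envelope x"
      using J.envelope_ge[of "jet x" x] that by (simp add: jet_def)
  qed
  have Ysub: "subspace Y"
    by (simp add: Y)
  have GY: "G x - G y \<in> Y" if "x \<in> E" "y \<in> E" for x y
    unfolding Y using that by (intro span_base) blast

  \<comment> \<open>Finitely many gradients whose differences span \<open>Y\<close>\<close>
  obtain B where B: "B \<subseteq> {G x - G y | x y. x \<in> E \<and> y \<in> E}" "independent B"
    "{G x - G y | x y. x \<in> E \<and> y \<in> E} \<subseteq> span B"
    using maximal_independent_subset by blast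
  have "\<forall>b\<in>B. \<exists>x y. x \<in> E \<and> y \<in> E \<and> b = G x - G y"
    using B(1) by blast
  then obtain px py where pxy: "\<And>b. b \<in> B \<Longrightarrow> px b \<in> E" "\<And>b. b \<in> B \<Longrightarrow> py b \<in> E"
    "\<And>b. b \<in> B \<Longrightarrow> b = G (px b) - G (py b)"
    by metis
  define A0 where "A0 = G ` (px ` B \<union> py ` B)"
  have "finite A0"
    using independent_imp_finite[OF B(2)] by (simp add: A0_def)
  have A0E: "A0 \<subseteq> G ` E"
    using pxy(1,2) by (auto simp: A0_def)
  have span_A0: "span {g - g' | g g'. g \<in> A0 \<and> g' \<in> A0} = Y"
  proof
    show "span {g - g' | g g'. g \<in> A0 \<and> g' \<in> A0} \<subseteq> Y"
      unfolding Y using A0E by (intro span_mono) blast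
    have "B \<subseteq> {g - g' | g g'. g \<in> A0 \<and> g' \<in> A0}"
      using pxy(3) by (force simp: A0_def)
    then have "span B \<subseteq> span {g - g' | g g'. g \<in> A0 \<and> g' \<in> A0}"
      by (rule span_mono)
    then show "Y \<subseteq> span {g - g' | g g'. g \<in> A0 \<and> g' \<in> A0}"
      unfolding Y using B(3) by (intro span_minimal) auto
  qed
  \<comment> \<open>Otherwise \<open>Y\<close> would be trivial and \<open>G\<close> constant. Two
    distinct gradients force \<open>norm a < M\<close>.\<close>
  have "\<exists>g1\<in>A0. \<exists>g2\<in>A0. g1 \<noteq> g2"
  proof (rule ccontr)
    assume "\<not> ?thesis"
    then have "g - g' = 0" if "g \<in> A0" "g' \<in> A0" for g g'
      using that right_minus_eq by blast
    then have "{g - g' | g g'. g \<in> A0 \<and> g' \<in> A0} \<subseteq> {0}"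
      by blast
    then have "Y \<subseteq> span {0}"
      unfolding span_A0[symmetric] by (rule span_mono)
    then have "G x - G x1 = 0" if "x \<in> E" for x
      using GY[OF that x1] by auto
    then show False
      using non_constant unfolding constant_on_def right_minus_eq by blast
  qed
  then obtain g1 g2 where g12: "g1 \<in> A0" "g2 \<in> A0" "g1 \<noteq> g2"
    by blast
  then have "A0 \<noteq> {}"
    by blast
  define a where "a = (\<Sum>A0) /\<^sub>R card A0"
  have "A0 \<subseteq> fst ` jet ` E"
    using A0E by (auto simp: jet_def image_image)
  then obtain r0 C0 where r0: "0 < r0"
    and low0: "\<And>x. r0 * norm (orth_proj Y x) - C0 \<le> J.envelope x - a \<bullet> x"
    using J.envelope_coercive[OF \<open>finite A0\<close> \<open>A0 \<noteq> {}\<close>] unfolding span_A0 a_def by blast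
  have "norm a < M"
    unfolding a_def using \<open>finite A0\<close> A0E GM g12 by (intro norm_average_less[of A0 M g1 g2]) auto

  \<comment> \<open>Additional affine functions for the directions missing from
    \<open>Y\<close>\<close>
  define J where "J = {1..dim X - dim Y}"
  obtain p :: "nat \<Rightarrow> real ^ 'n" and \<epsilon> :: real and w :: "nat \<Rightarrow> real ^ 'n"
    where \<epsilon>: "0 < \<epsilon>" and w: "\<And>j. j \<in> J \<Longrightarrow> norm (w j) = 1" "\<And>j. j \<in> J \<Longrightarrow> w j \<in> X \<inter> Y\<^sup>\<bottom>"
      "inj_on w J" "independent (w ` J)"
      and cone: "\<And>j. j \<in> J \<Longrightarrow> cone_at Y \<epsilon> (w j) (p j) \<inter> closure E = {}"
  proof (cases "Y = X")
    case True
    then show ?thesis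
      \<comment> \<open>Here \<open>J\<close> is empty, so 1 is a mere placeholder for
        \<open>\<epsilon>\<close>.\<close>
      using that[of 1] by (simp add: J_def independent_empty)
  next
    case False
    from iii[OF this, folded J_def] obtain p :: "nat \<Rightarrow> real ^ 'n" and \<epsilon> :: real
      and w :: "nat \<Rightarrow> real ^ 'n"
      where "0 < \<epsilon>" "\<forall>j\<in>J. norm (w j) = 1 \<and> w j \<in> X \<inter> Y\<^sup>\<bottom>" "inj_on w J" "independent (w ` J)"
        "\<forall>j\<in>J. cone_at Y \<epsilon> (w j) (p j) \<inter> closure E = {}"
      by (elim exE conjE)
    then show ?thesis
      by (intro that[of \<epsilon> w p]) auto
  qed
  \<comment> \<open>The first bound lets growth along \<open>w j\<close> outside the cone be paid by
    coercivity along \<open>Y\<close>; the second keeps the new gradients within norm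
    \<open>M\<close>.\<close>
  define \<delta> where "\<delta> = min (\<epsilon> * r0) (M - norm a)"
  have \<delta>: "0 < \<delta>" "\<delta> \<le> \<epsilon> * r0" "norm a + \<delta> \<le> M"
    using \<epsilon> r0 \<open>norm a < M\<close> by (auto simp: \<delta>_def)
  \<comment> \<open>The function is
    \<open>a \<bullet> x + \<delta> * (w j \<bullet> (x - p j))\<close> lowered by three amounts:
    \<open>r0 * norm (p j)\<close> for replacing the projection of \<open>x - p j\<close> by that of
    \<open>x\<close>, \<open>C0\<close> from \<open>low0\<close>, and 1 for a uniform gap.\<close>
  define new where "new j = (a + \<delta> *\<^sub>R w j, - \<delta> * (w j \<bullet> p j) - r0 * norm (p j) - C0 - 1)" for j
  have new_le: "fst (new j) \<bullet> x + snd (new j) \<le> f x - 1" if "j \<in> J" "x \<in> E" for j x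
  proof -
    have "x \<notin> cone_at Y \<epsilon> (w j) (p j)"
      using cone[OF that(1)] that(2) closure_subset by blast
    then have "\<epsilon> * (w j \<bullet> (x - p j)) < norm (orth_proj Y (x - p j))"
      by (simp add: cone_at_def)
    then have "r0 * (\<epsilon> * (w j \<bullet> (x - p j))) \<le> r0 * norm (orth_proj Y (x - p j))"
      using r0 by simp
    moreover have "\<delta> * (w j \<bullet> (x - p j)) \<le> r0 * (\<epsilon> * (w j \<bullet> (x - p j))) \<or> \<delta> * (w j \<bullet> (x - p j)) \<le> 0"
      using \<delta> mult_right_mono[OF \<delta>(2), of "w j \<bullet> (x - p j)"]
      by (cases "0 \<le> w j \<bullet> (x - p j)") (auto simp: mult_ac mult_nonneg_nonpos)
    moreover have "0 \<le> r0 * norm (orth_proj Y (x - p j))"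
      using r0 by simp
    ultimately have "\<delta> * (w j \<bullet> (x - p j)) \<le> r0 * norm (orth_proj Y (x - p j))"
      by linarith
    also have "norm (orth_proj Y (x - p j)) \<le> norm (orth_proj Y x) + norm (p j)"
      using norm_triangle_ineq4[of "orth_proj Y x" "orth_proj Y (p j)"] norm_orth_proj_le[OF Ysub, of "p j"]
      by (simp add: orth_proj_diff[OF Ysub])
    finally have "\<delta> * (w j \<bullet> (x - p j)) \<le> r0 * (norm (orth_proj Y x) + norm (p j))"
      using r0 by simp
    then show ?thesis
      using low0[of x] J_eq[OF that(2)]
      by (simp add: new_def inner_add_left inner_diff_right algebra_simps)
  qed

  \<comment> \<open>The combined envelope \<open>m\<close>\<close>
  define \<Psi> where "\<Psi> = jet ` E \<union> new ` J"
  have new_norm: "norm (fst (new j)) \<le> M" if "j \<in> J" for j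
    using norm_triangle_ineq[of a "\<delta> *\<^sub>R w j"] \<delta> w(1)[OF that] by (simp add: new_def)
  have \<Psi>_le: "fst \<psi> \<bullet> x + snd \<psi> \<le> f x" if "\<psi> \<in> \<Psi>" "x \<in> E" for \<psi> x
    using that jet_le[OF that(2)] new_le[OF _ that(2)] by (fastforce simp: \<Psi>_def)
  interpret P: affine_family \<Psi> M x1 "f x1"
  proof
    show "\<Psi> \<noteq> {}"
      using x1 by (auto simp: \<Psi>_def)
    show "norm (fst \<psi>) \<le> M" if "\<psi> \<in> \<Psi>" for \<psi>
      using that GM new_norm by (auto simp: \<Psi>_def jet_def)
    show "fst \<psi> \<bullet> x1 + snd \<psi> \<le> f x1" if "\<psi> \<in> \<Psi>" for \<psi>
      using \<Psi>_le[OF that x1] .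
  qed
  define m where "m = P.envelope"
  have m_eq: "m x = f x" if "x \<in> E" for x
  proof (rule antisym)
    show "m x \<le> f x"
      unfolding m_def using \<Psi>_le[OF _ that] by (rule P.envelope_le)
    show "f x \<le> m x"
      using P.envelope_ge[of "jet x" x] that by (simp add: jet_def \<Psi>_def m_def)
  qed

  \<comment> \<open>Coercivity of \<open>m\<close> on \<open>X\<close> and linearity along its
    complement\<close>
  define A where "A = A0 \<union> fst ` new ` J"
  define v where "v = (\<Sum>A) /\<^sub>R card A"
  have A: "finite A" "A \<noteq> {}" "A \<subseteq> fst ` \<Psi>"
    using \<open>finite A0\<close> \<open>A0 \<noteq> {}\<close> \<open>A0 \<subseteq> fst ` jet ` E\<close> by (auto simp: A_def \<Psi>_def J_def)
  have aX: "g - a \<in> X" if "g \<in> A" for g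
  proof -
    obtain g0 where g0: "g0 \<in> A0"
      using \<open>A0 \<noteq> {}\<close> by blast
    show ?thesis
    proof (cases "g \<in> A0")
      case True
      then show ?thesis
        using average_diff_in_span[OF \<open>finite A0\<close>] ii unfolding span_A0 a_def by blast
    next
      case False
      then show ?thesis
        using that w(2) X by (auto simp: A_def new_def subspace_scale)
    qed
  qed
  have jX: "fst \<psi> - a \<in> X" if \<psi>: "\<psi> \<in> \<Psi>" for \<psi>
  proof (cases "\<psi> \<in> jet ` E")
    case True
    then obtain z where z: "z \<in> E" "fst \<psi> = G z"
      by (auto simp: jet_def)
    obtain z0 where z0: "z0 \<in> E" "G z0 = g1"
      using g12(1) A0E by auto
    have "G z - G z0 \<in> X"
      using GY z(1) z0(1) ii by blast
    moreover have "g1 - a \<in> X"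
      using aX g12(1) by (simp add: A_def)
    ultimately have "(G z - G z0) + (g1 - a) \<in> X"
      by (rule subspace_add[OF X])
    then show ?thesis
      using z z0 by simp
  next
    case False
    then show ?thesis
      using \<psi> aX by (auto simp: A_def \<Psi>_def)
  qed
  have span_A: "span {g - g' | g g'. g \<in> A \<and> g' \<in> A} = X" (is "?S = X")
  proof
    have "g - g' \<in> X" if "g \<in> A" "g' \<in> A" for g g'
      using subspace_diff[OF X aX[OF that(1)] aX[OF that(2)]] by simp
    then show "?S \<subseteq> X"
      by (intro span_minimal X) auto
    show "X \<subseteq> ?S"
    proof (rule orthogonal_extension_spans[OF X Ysub ii _ w(4)])
      show "finite (w ` J)" "w ` J \<subseteq> X \<inter> Y\<^sup>\<bottom>" "card (w ` J) = dim X - dim Y"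
        using w(2) card_image[OF w(3)] by (auto simp: J_def)
      show "subspace ?S"
        by simp
      show YS: "Y \<subseteq> ?S"
        unfolding span_A0[symmetric] by (intro span_mono) (auto simp: A_def)
      show "w ` J \<subseteq> ?S"
      proof
        fix u assume "u \<in> w ` J"
        then obtain j where j: "j \<in> J" "u = w j"
          by blast
        \<comment> \<open>Adding \<open>g1 - a\<close>, which lies in \<open>Y\<close>, isolates the
          perturbation \<open>\<delta> *\<^sub>R w j\<close> of the new gradient.\<close>
        have "fst (new j) - g1 \<in> ?S"
          using j(1) g12(1) by (intro span_base) (auto simp: A_def)
        moreover have "g1 - a \<in> ?S"
          using average_diff_in_span[OF \<open>finite A0\<close> g12(1)] YS unfolding span_A0 a_def by blast
        ultimately have "(fst (new j) - g1) + (g1 - a) \<in> ?S"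
          by (rule span_add)
        then have "\<delta> *\<^sub>R u \<in> ?S"
          by (simp add: new_def j(2))
        then have "(1 / \<delta>) *\<^sub>R \<delta> *\<^sub>R u \<in> ?S"
          by (rule span_scale)
        then show "u \<in> ?S"
          using \<delta>(1) by simp
      qed
    qed
  qed
  obtain r C where r: "0 < r" and low: "\<And>x. r * norm (orth_proj X x) - C \<le> m x - v \<bullet> x"
    using P.envelope_coercive[OF A] unfolding span_A v_def m_def by blast
  have vX: "g1 - v \<in> X"
    using average_diff_in_span[OF A(1), of g1] g12(1) unfolding span_A v_def by (simp add: A_def)
  have \<Psi>_shift: "fst \<psi> \<bullet> u = v \<bullet> u" if "\<psi> \<in> \<Psi>" "u \<in> X\<^sup>\<bottom>" for \<psi> u
  proof -
    have "g1 - a \<in> X"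
      using aX[of g1] g12(1) by (simp add: A_def)
    then have "((fst \<psi> - a) - (g1 - a)) + (g1 - v) \<in> X"
      by (rule subspace_add[OF X subspace_diff[OF X jX[OF that(1)]] vX])
    then have "(fst \<psi> - v) \<bullet> u = 0"
      using inner_orthogonal_comp[OF _ that(2)] by simp
    then show ?thesis
      by (simp add: inner_diff_left)
  qed

  \<comment> \<open>The contact set and supergradients of \<open>m\<close> on it\<close>
  define K where "K = closure {x + u | x u. x \<in> E \<and> u \<in> X\<^sup>\<bottom>}"
  have EK: "x \<in> K" if "x \<in> E" for x
  proof -
    have "x + 0 \<in> {x + u | x u. x \<in> E \<and> u \<in> X\<^sup>\<bottom>}"
      using that subspace_0[OF subspace_orthogonal_comp] by blast
    then show ?thesis
      unfolding K_def using closure_subset by fastforce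
  qed
  have K_shift: "(+) u ` K = K" if "u \<in> X\<^sup>\<bottom>" for u
    unfolding K_def
  proof (rule closure_translate_eq)
    fix x assume "x \<in> {x + u | x u. x \<in> E \<and> u \<in> X\<^sup>\<bottom>}"
    then obtain y t where y: "y \<in> E" "t \<in> X\<^sup>\<bottom>" "x = y + t"
      by blast
    have "t + u \<in> X\<^sup>\<bottom>" "t - u \<in> X\<^sup>\<bottom>"
      using y(2) that by (auto intro: subspace_add subspace_diff subspace_orthogonal_comp)
    moreover have "x + u = y + (t + u)" "x - u = y + (t - u)"
      by (simp_all add: y(3))
    ultimately show "x + u \<in> {x + u | x u. x \<in> E \<and> u \<in> X\<^sup>\<bottom>}"
      "x - u \<in> {x + u | x u. x \<in> E \<and> u \<in> X\<^sup>\<bottom>}"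
      using y(1) by blast+
  qed
  have m_sg: "\<exists>\<xi>. has_supergradient m \<xi> x" if "x \<in> K" for x
    unfolding m_def
  proof (rule P.has_supergradient_envelope[OF X \<Psi>_shift, where f = f and G = G and E = E])
    show "(G z, f z - G z \<bullet> z) \<in> \<Psi>" if "z \<in> E" for z
      using that by (auto simp: \<Psi>_def jet_def)
    show "fst \<psi> \<bullet> x + snd \<psi> \<le> f x - 1"
      if "\<psi> \<in> \<Psi>" "\<psi> \<notin> (\<lambda>z. (G z, f z - G z \<bullet> z)) ` E" "x \<in> E" for \<psi> x
      using that new_le[OF _ \<open>x \<in> E\<close>] by (auto simp: \<Psi>_def jet_def)
    show "P.envelope x = f x" if "x \<in> E" for x
      using m_eq[OF that] by (simp add: m_def)
    show "x \<in> closure {x + w | x w. x \<in> E \<and> w \<in> X\<^sup>\<bottom>}"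
      using that by (simp add: K_def)
  qed (use iv in auto)

  \<comment> \<open>The \<open>C^1\<close> extension and its Lipschitz constant\<close>
  have "lipschitz_with_contact_set m M K"
  proof
    show "0 \<le> M"
      by (rule P.M_nonneg)
    show "m y \<le> m x + M * norm (y - x)" for x y
      unfolding m_def by (rule P.lipschitz_envelope)
    show "closed K"
      by (simp add: K_def)
    show "K \<noteq> {}"
      using EK[OF x1] by blast
  qed
  moreover have "convex_on UNIV m"
    unfolding m_def by (rule P.convex_on_envelope)
  moreover have "m (x + u) = m x + v \<bullet> u" if "u \<in> X\<^sup>\<bottom>" for x u
    unfolding m_def using \<Psi>_shift[OF _ that] by (rule P.envelope_shift)
  ultimately obtain F DF where F: "convex_on UNIV F" "\<And>x y. F y \<le> F x + M * norm (y - x)"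
    "\<And>x. has_supergradient F (DF x) x" "\<And>x. m x \<le> F x" "\<And>x. x \<in> K \<Longrightarrow> F x = m x"
    "coercive_directions F = X"
    using convex_C1_majorant[OF _ _ X _ K_shift r low m_sg] by metis
  have D: "GDERIV F x :> DF x" for x
    by (rule convex_supergradient_GDERIV[OF F(1,3)])
  have Ff: "F x = f x" if "x \<in> E" for x
    using F(5)[OF EK[OF that]] m_eq[OF that] by simp
  \<comment> \<open>The affine function of the jet at \<open>x\<close> lies below \<open>m\<close>,
    hence below \<open>F\<close>, and touches \<open>F\<close> at \<open>x\<close>; so
    \<open>G x\<close> is a subgradient and coincides with the supergradient
    \<open>DF x\<close>.\<close>
  have DG: "DF x = G x" if "x \<in> E" for x
  proof -
    have "F y \<ge> F x + G x \<bullet> (y - x)" for y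
    proof -
      have "G x \<bullet> y + (f x - G x \<bullet> x) \<le> m y"
        unfolding m_def using P.envelope_ge[of "jet x" y] that by (simp add: jet_def \<Psi>_def)
      then show ?thesis
        using F(4)[of y] Ff[OF that] by (simp add: inner_diff_right)
    qed
    then show ?thesis
      using supergradient_subgradient_unique[OF F(3)] by metis
  qed
  have DM: "norm (DF x) \<le> M" for x
    by (rule GDERIV_norm_le_lipschitz[OF F(1) D F(2)])
  have lip: "M-lipschitz_on UNIV F"
    by (rule lipschitz_on_UNIV_I[OF P.M_nonneg F(2)])
  have "E \<noteq> {}"
    using x1 by blast
  have bddD: "bdd_above (range (\<lambda>x. norm (DF x)))"
    using DM by (intro bdd_aboveI2)
  have supD: "(SUP x. norm (DF x)) = M"
  proof (rule antisym)
    show "(SUP x. norm (DF x)) \<le> M"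
      using DM by (intro cSUP_least) auto
    have "norm (G y) \<le> (SUP x. norm (DF x))" if "y \<in> E" for y
      using cSUP_upper[OF UNIV_I bddD, of y] DG[OF that] by simp
    then show "M \<le> (SUP x. norm (DF x))"
      unfolding M_def using \<open>E \<noteq> {}\<close> by (intro cSUP_least)
  qed
  have "Lip F = M"
    unfolding Lip_def
  proof (rule cInf_eq_minimum)
    show "M \<in> {L. L-lipschitz_on UNIV F}"
      using lip by simp
    fix L assume "L \<in> {L. L-lipschitz_on UNIV F}"
    then have L: "L-lipschitz_on UNIV F"
      by simp
    have "F y \<le> F x + L * norm (y - x)" for x y
      using lipschitz_onD[OF L, of y x] by (simp add: dist_real_def dist_norm)
    then have "norm (DF x) \<le> L" for x
      by (intro GDERIV_norm_le_lipschitz[OF F(1) D])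
    then show "M \<le> L"
      unfolding supD[symmetric] by (intro cSUP_least) auto
  qed
  then have "Lip F = (SUP x. norm (DF x))" "(SUP x. norm (DF x)) = (SUP y\<in>E. norm (G y))"
    by (simp_all only: supD M_def)
  moreover have "\<exists>L. L-lipschitz_on UNIV F" "\<forall>x. GDERIV F x :> DF x" "continuous_on UNIV DF"
    "\<forall>x\<in>E. F x = f x \<and> DF x = G x"
    using lip D continuous_on_gradient_convex[OF F(1,3,2)] Ff DG by auto
  ultimately show ?thesis
    using F(1,6) by (intro exI[of _ F] exI[of _ DF] conjI)
qed

end
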